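(* Let $C$ be a class of computational models, and let $C(f)$ denote the minimum size of a model in $C$ computing $f$. Suppose: (1) a $1-\exp(-\Omega(n))$ fraction of the boolean functions on $n$ variables satisfy $C(f)\ge l(n)$; (2) there is a pseudorandom function ensemble $\{F_n\}$ such that $\max_{f\in F_n}C(f)=u(n)$; (3) there exist $\varepsilon>0$ and a function $\alpha(n)>0$ such that $u(2^{n/\varepsilon})\le\frac{1}{\alpha(n)^2}\,l(n)$ for every large enough $n$. Then there is no polynomial-time algorithm $A$ such that $\frac{C(f)}{\alpha(n)}\le A(T_f)\le\alpha(n)\,C(f)$ for every boolean function $f$ on $n$ variables given by its truth table $T_f$.
   Context: A pseudorandom function ensemble (PRFE) is a family $\{F_n\}_{n\in\mathbb{N}}$ where $F_n$ is a set of boolean functions on $n$ variables, such that for every probabilistic polynomial-time oracle machine $A$, every polynomial $p$ and every large enough $n$, $|\Pr[A^{F_n}(1^n)=1]-\Pr[A^{H_n}(1^n)=1]|\le 1/p(n)$, where $A^{F_n}$ has oracle access to a uniformly random function from $F_n$, $A^{H_n}$ has oracle access to a uniformly random boolean function on $n$ variables, and probabilities are over the function and $A$'s coins.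
   Formalization: The class C is additionally assumed to contain a model for every boolean function, to have C(f) not increase when a variable is fixed to a constant, and to have C(f) unbounded over all boolean functions; for arbitrary C the claim fails. Also 2^{n/ε} is rounded down. *)

theory Defs
  imports "HOL-Probability.Probability" "HOL-Computational_Algebra.Polynomial"
begin

section \<open>Boolean functions and truth tables\<close>

text \<open>
  A Boolean function on \<open>n\<close> variables is a predicate on bit strings that is \<open>False\<close> outside
  length \<open>n\<close>, so that each function has exactly one representative and \<open>boolfuns n\<close> has
  \<open>2 ^ 2 ^ n\<close> elements. The constant \<open>False\<close> function belongs to every \<open>boolfuns n\<close>, so notions
  that depend on the number of variables take \<open>n\<close> as a separate argument.
\<close>

type_synonym boolfun = "bool list \<Rightarrow> bool"

definition boolfuns :: "nat \<Rightarrow> boolfun set" where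
  "boolfuns n = {f. \<forall>x. f x \<longrightarrow> length x = n}"

definition truth_table :: "nat \<Rightarrow> boolfun \<Rightarrow> bool list" where
  "truth_table n f = map f (List.n_lists n [False, True])"

definition fix_var :: "nat \<Rightarrow> bool \<Rightarrow> boolfun \<Rightarrow> boolfun" where
  "fix_var i b f = (\<lambda>x. f (take i x @ b # drop i x))"


section \<open>Probabilistic oracle machines\<close>

text \<open>
  Machines are programs over finitely many stacks of bits. A work tape is a pair of stacks, and
  conversely each elementary operation is a bounded number of steps of a multi-tape machine, so
  polynomial time is the usual notion. \<open>Flip i\<close> pushes a fair coin on stack \<open>i\<close>. \<open>Query q a\<close>
  pushes on stack \<open>a\<close> the oracle's answer to the string stored on stack \<open>q\<close>; if the oracle is a
  function on \<open>n\<close> variables, strings of any other length are answered \<open>False\<close>.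
  \<open>Branch i p q r\<close> runs \<open>p\<close>, \<open>q\<close> or \<open>r\<close> according to whether the top of stack \<open>i\<close> is
  \<open>True\<close>, is \<open>False\<close>, or the stack is empty; \<open>While i p\<close> iterates \<open>p\<close> as long as stack \<open>i\<close> is
  nonempty.
\<close>

datatype prog =
    Skip
  | Push nat bool
  | Pop nat
  | Flip nat
  | Query nat nat
  | Seq prog prog
  | Branch nat prog prog prog
  | While nat prog

type_synonym store = "nat \<Rightarrow> bool list"

text \<open>The first component of a configuration is the list of programs still to be executed.\<close>

type_synonym config = "prog list \<times> store"

fun step :: "boolfun \<Rightarrow> config \<Rightarrow> config pmf" where
  "step f ([], s) = return_pmf ([], s)"
| "step f (Skip # ps, s) = return_pmf (ps, s)"
| "step f (Push i b # ps, s) = return_pmf (ps, s(i := b # s i))"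
| "step f (Pop i # ps, s) = return_pmf (ps, s(i := tl (s i)))"
| "step f (Flip i # ps, s) = map_pmf (\<lambda>b. (ps, s(i := b # s i))) (pmf_of_set UNIV)"
| "step f (Query q a # ps, s) = return_pmf (ps, s(a := f (s q) # s a))"
| "step f (Seq p q # ps, s) = return_pmf (p # q # ps, s)"
| "step f (Branch i p q r # ps, s) =
     return_pmf ((case s i of [] \<Rightarrow> r | b # _ \<Rightarrow> if b then p else q) # ps, s)"
| "step f (While i p # ps, s) =
     return_pmf (if s i = [] then (ps, s) else (p # While i p # ps, s))"

definition run :: "prog \<Rightarrow> boolfun \<Rightarrow> bool list \<Rightarrow> nat \<Rightarrow> config pmf" where
  "run M f x t = ((\<lambda>D. bind_pmf D (step f)) ^^ t) (return_pmf ([M], (\<lambda>_. [])(0 := x)))"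

definition time_bound :: "prog \<Rightarrow> nat poly \<Rightarrow> bool" where
  "time_bound M p \<longleftrightarrow>
     (\<forall>f x. \<forall>c \<in> set_pmf (run M f x (poly p (length x))). fst c = [])"

text \<open>
  The probability that \<open>M\<close> with input \<open>1\<^sup>n\<close> and a uniformly random oracle from \<open>F\<close> has halted
  with output \<open>1\<close> after \<open>t\<close> steps. Halted configurations are stationary, so \<open>t\<close> is immaterial
  once it is at least the running time.
\<close>

definition accept_prob :: "prog \<Rightarrow> boolfun set \<Rightarrow> nat \<Rightarrow> nat \<Rightarrow> real" where
  "accept_prob M F n t =
     measure_pmf.prob (bind_pmf (pmf_of_set F) (\<lambda>f. run M f (replicate n True) t))
       {(ps, s). ps = [] \<and> s 0 = [True]}"

definition prfe :: "(nat \<Rightarrow> boolfun set) \<Rightarrow> bool" where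
  "prfe F \<longleftrightarrow>
     (\<forall>n. F n \<noteq> {} \<and> F n \<subseteq> boolfuns n) \<and>
     (\<forall>M p. time_bound M p \<longrightarrow>
       (\<forall>q :: real poly. (\<forall>\<^sub>F n in sequentially. poly q (real n) > 0) \<longrightarrow>
         (\<forall>\<^sub>F n in sequentially.
            \<bar>accept_prob M (F n) n (poly p n) - accept_prob M (boolfuns n) n (poly p n)\<bar>
              \<le> 1 / poly q (real n))))"


section \<open>Polynomial-time algorithms with numerical output\<close>

fun deterministic :: "prog \<Rightarrow> bool" where
  "deterministic (Flip i) = False"
| "deterministic (Query q a) = False"
| "deterministic (Seq p q) = (deterministic p \<and> deterministic q)"
| "deterministic (Branch i p q r) = (deterministic p \<and> deterministic q \<and> deterministic r)"
| "deterministic (While i p) = deterministic p"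
| "deterministic _ = True"

text \<open>
  Outputs are arbitrary nonnegative rationals: stack 0 holds the numerator and stack 1 the
  denominator minus one, both in binary with the least significant bit on top. An empty
  stack 1 thus gives an integer output.
\<close>

definition out_value :: "store \<Rightarrow> real" where
  "out_value s = real (horner_sum of_bool 2 (s 0)) / real (horner_sum of_bool 2 (s 1) + 1)"

definition poly_time_computable :: "(bool list \<Rightarrow> real) \<Rightarrow> bool" where
  "poly_time_computable A \<longleftrightarrow>
     (\<exists>P p. deterministic P \<and>
       (\<forall>x. \<exists>s. run P (\<lambda>_. False) x (poly p (length x)) = return_pmf ([], s) \<and> A x = out_value s))"


section \<open>Classes of computational models\<close>

text \<open>
  The type \<open>'m\<close> is the type of models; \<open>computes M n f\<close> means that \<open>M\<close> computes the function \<open>f\<close>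
  on \<open>n\<close> variables. Besides the requirement that every function has a model, two properties
  common to circuits, formulas, branching programs etc. are part of the notion: substituting a
  constant for a variable does not increase the size, and models of bounded size do not compute
  all Boolean functions.
\<close>

locale model_class =
  fixes computes :: "'m \<Rightarrow> nat \<Rightarrow> boolfun \<Rightarrow> bool"
    and msize :: "'m \<Rightarrow> nat"
  assumes complete: "f \<in> boolfuns n \<Longrightarrow> \<exists>M. computes M n f"
    and restriction: "\<lbrakk>f \<in> boolfuns (Suc n); computes M (Suc n) f; i \<le> n\<rbrakk>
      \<Longrightarrow> \<exists>M'. computes M' n (fix_var i b f) \<and> msize M' \<le> msize M"
    and unbounded: "\<exists>n. \<exists>f \<in> boolfuns n. \<forall>M. computes M n f \<longrightarrow> s < msize M"

definition complexity ::
  "('m \<Rightarrow> nat \<Rightarrow> boolfun \<Rightarrow> bool) \<Rightarrow> ('m \<Rightarrow> nat) \<Rightarrow> nat \<Rightarrow> boolfun \<Rightarrow> nat" where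
  "complexity computes msize n f = (LEAST s. \<exists>M. computes M n f \<and> msize M = s)"

end

(*
  On input 1^m put k = K * bitlen m with K >= epsilon. The distinguisher builds the truth table of the
  oracle restricted to k variables (a string of length polynomial in m), draws a uniformly random
  truth table on k variables, and accepts iff A is smaller on the former. For a random oracle the two
  tables are identically distributed, so it accepts with probability at most 1/2. For a pseudorandom
  oracle, restriction does not increase the complexity, and the gap between u and l makes A smaller on the
  restricted function than on almost every random one. No threshold appears, hence neither alpha nor l
  nor u has to be computable.

  The gap only yields a non-strict inequality. Since tables of pseudorandom functions contain every fixed
  pattern, u tends to infinity, so there are infinitely many n whose value u (2^(n/epsilon)) is smaller than
  all later ones. At m = 2^(n/epsilon) we have k > n, and the inequality becomes strict.
*)

theory Submission
  imports Defs "HOL-Real_Asymp.Real_Asymp"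
begin

section \<open>Execution of programs\<close>

text \<open>Let \<open>\<mu> n\<close> be the integer part of
  \<open>2 powr (n / \<epsilon>)\<close>. The program cannot know \<open>\<epsilon>\<close>, so its
  table size \<open>k\<close> is an integer multiple of the bit length of \<open>m\<close>, and in
  general it differs from the \<open>n\<close> with \<open>m = \<mu> n\<close>. Hardness and gap are
  used at \<open>k\<close>, while the pseudorandom functions live at \<open>m\<close>. So
  \<open>u (\<mu> n)\<close> has to be compared with \<open>u (\<mu> k)\<close>, and
  \<open>u\<close> is not assumed monotone. A strict tail minimum of the composed sequence gives
  this comparison for every \<open>k > n\<close> at once. Strictness matters because of ties: with
  the test \<open><\<close> a tie is rejected, which could spoil the pseudorandom side, and with
  \<open>\<le>\<close> a tie is accepted, which would spoil the bound 1/2 on the random side. Most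
  of the text builds the distinguisher as an actual \<open>prog\<close>. The property
  \<open>time_bound\<close> ranges over all oracles and all inputs, so step counts are needed for
  every store that can occur. The given algorithm runs twice inside it as a subroutine, which calls
  for a frame argument on stacks, and its rational outputs are compared by exact binary
  arithmetic.\<close>

definition iter :: "boolfun \<Rightarrow> nat \<Rightarrow> config \<Rightarrow> config pmf" where
  "iter f t c = ((\<lambda>D. bind_pmf D (step f)) ^^ t) (return_pmf c)"

lemma run_eq_iter: "run M f x t = iter f t ([M], (\<lambda>_. [])(0 := x))"
  by (simp add: run_def iter_def)

text \<open>\<open>run\<close> adds each new step at the end. Pulling out the initial distribution
  lets \<open>iter_Suc\<close> unfold the first step instead, as reasoning along a program
  requires.\<close>

lemma bind_step_funpow:
  "((\<lambda>D. bind_pmf D (step f)) ^^ t) D = bind_pmf D (iter f t)"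
proof (induction t)
  case 0
  then show ?case by (simp add: iter_def bind_return_pmf')
next
  case (Suc t)
  then show ?case by (simp add: iter_def bind_assoc_pmf)
qed

lemma iter_0 [simp]: "iter f 0 c = return_pmf c"
  by (simp add: iter_def)

lemma iter_Suc: "iter f (Suc t) c = bind_pmf (step f c) (iter f t)"
proof -
  have "iter f (Suc t) c = ((\<lambda>D. bind_pmf D (step f)) ^^ t) (step f c)"
    unfolding iter_def funpow_Suc_right by (simp add: bind_return_pmf)
  then show ?thesis unfolding bind_step_funpow .
qed

lemma iter_add: "iter f (t + t') c = bind_pmf (iter f t c) (iter f t')"
proof -
  have "iter f (t + t') c = ((\<lambda>D. bind_pmf D (step f)) ^^ t') (iter f t c)"
    unfolding iter_def add.commute[of t t'] funpow_add by simp
  then show ?thesis unfolding bind_step_funpow .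
qed

lemma iter_halted [simp]: "iter f t ([], s) = return_pmf ([], s)"
  by (induction t) (auto simp: iter_Suc bind_return_pmf)

text \<open>One \<open>t\<close> serves all continuations \<open>ps\<close>, so that runs compose
  sequentially. \<open>T\<close> is only an upper bound and can be rounded up freely. The final
  store has to be certain, so random outcomes are treated separately.\<close>

definition ev :: "boolfun \<Rightarrow> prog \<Rightarrow> store \<Rightarrow> store \<Rightarrow> nat \<Rightarrow> bool" where
  "ev f p s s' T \<longleftrightarrow> (\<exists>t\<le>T. \<forall>ps. iter f t (p # ps, s) = return_pmf (ps, s'))"

lemma ev_mono: "ev f p s s' T \<Longrightarrow> T \<le> T' \<Longrightarrow> ev f p s s' T'"
  unfolding ev_def by (meson order_trans)

lemma ev_step1:
  assumes "\<And>ps. step f (p # ps, s) = return_pmf (ps, s')"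
  shows "ev f p s s' 1"
  unfolding ev_def by (rule exI[of _ 1]) (simp add: iter_Suc assms bind_return_pmf)

lemma ev_Seq:
  assumes "ev f p s s1 T1" "ev f q s1 s2 T2"
  shows "ev f (Seq p q) s s2 (Suc (T1 + T2))"
proof -
  obtain t1 t2 where "t1 \<le> T1" "\<forall>ps. iter f t1 (p # ps, s) = return_pmf (ps, s1)"
    "t2 \<le> T2" "\<forall>ps. iter f t2 (q # ps, s1) = return_pmf (ps, s2)"
    using assms unfolding ev_def by blast
  then show ?thesis
    unfolding ev_def
    by (intro exI[of _ "Suc (t1 + t2)"]) (auto simp: iter_Suc iter_add bind_return_pmf)
qed

lemma ev_Branch:
  assumes "ev f (case s i of [] \<Rightarrow> r | b # _ \<Rightarrow> if b then p else q) s s' T"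
  shows "ev f (Branch i p q r) s s' (Suc T)"
proof -
  obtain t where "t \<le> T"
    "\<forall>ps. iter f t ((case s i of [] \<Rightarrow> r | b # _ \<Rightarrow> if b then p else q) # ps, s) = return_pmf (ps, s')"
    using assms unfolding ev_def by blast
  then show ?thesis
    unfolding ev_def
    by (intro exI[of _ "Suc t"]) (auto simp: iter_Suc bind_return_pmf)
qed

lemma ev_While_Nil:
  assumes "s i = []" "s' = s" "T \<ge> 1"
  shows "ev f (While i p) s s' T"
  using ev_step1[of f "While i p" s s] assms by (auto intro: ev_mono)

lemma ev_While_step:
  assumes "s i \<noteq> []" "ev f p s s1 T1" "ev f (While i p) s1 s2 T2"
  shows "ev f (While i p) s s2 (Suc (T1 + T2))"
proof -
  obtain t1 t2 where "t1 \<le> T1" "\<forall>ps. iter f t1 (p # ps, s) = return_pmf (ps, s1)"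
    "t2 \<le> T2" "\<forall>ps. iter f t2 (While i p # ps, s1) = return_pmf (ps, s2)"
    using assms unfolding ev_def by blast
  then show ?thesis
    unfolding ev_def using assms(1)
    by (intro exI[of _ "Suc (t1 + t2)"]) (auto simp: iter_Suc iter_add bind_return_pmf)
qed

section \<open>Loop-free programs and loops with explicit invariants\<close>

fun block :: "prog list \<Rightarrow> prog" where
  "block [] = Skip"
| "block [p] = p"
| "block (p # ps) = Seq p (block ps)"

fun loop_free :: "prog \<Rightarrow> bool" where
  "loop_free (Flip i) = False"
| "loop_free (While i p) = False"
| "loop_free (Seq p q) = (loop_free p \<and> loop_free q)"
| "loop_free (Branch i p q r) = (loop_free p \<and> loop_free q \<and> loop_free r)"
| "loop_free _ = True"

fun eval_lf :: "boolfun \<Rightarrow> prog \<Rightarrow> store \<Rightarrow> store" where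
  "eval_lf f (Push i b) s = s(i := b # s i)"
| "eval_lf f (Pop i) s = s(i := tl (s i))"
| "eval_lf f (Query q a) s = s(a := f (s q) # s a)"
| "eval_lf f (Seq p q) s = eval_lf f q (eval_lf f p s)"
| "eval_lf f (Branch i p q r) s =
     (case s i of [] \<Rightarrow> eval_lf f r s | b # _ \<Rightarrow> if b then eval_lf f p s else eval_lf f q s)"
| "eval_lf f _ s = s"

fun cost :: "prog \<Rightarrow> nat" where
  "cost (Seq p q) = Suc (cost p + cost q)"
| "cost (Branch i p q r) = Suc (max (cost p) (max (cost q) (cost r)))"
| "cost _ = 1"

text \<open>\<open>cost\<close> takes the maximum over branches, so the bound is independent of the
  store. Loop bodies can then be verified by symbolic evaluation, and only loops need an
  induction.\<close>

lemma ev_loop_free: "loop_free p \<Longrightarrow> ev f p s (eval_lf f p s) (cost p)"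
proof (induction p arbitrary: s)
  case (Branch i p q r)
  let ?T = "max (cost p) (max (cost q) (cost r))"
  have "ev f p s (eval_lf f p s) ?T" "ev f q s (eval_lf f q s) ?T" "ev f r s (eval_lf f r s) ?T"
    by (rule ev_mono[OF Branch.IH(1)] ev_mono[OF Branch.IH(2)] ev_mono[OF Branch.IH(3)];
        use Branch.prems in simp)+
  then have "ev f (case s i of [] \<Rightarrow> r | b # _ \<Rightarrow> if b then p else q) s
      (eval_lf f (Branch i p q r) s) ?T"
    by (simp split: list.split)
  then show ?case unfolding cost.simps by (rule ev_Branch)
next
  case (Seq p q)
  have "ev f p s (eval_lf f p s) (cost p)"
    "ev f q (eval_lf f p s) (eval_lf f q (eval_lf f p s)) (cost q)"
    by (rule Seq.IH; use Seq.prems in simp)+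
  then show ?case unfolding cost.simps eval_lf.simps by (rule ev_Seq)
next
  case Skip show ?case unfolding cost.simps eval_lf.simps by (rule ev_step1, rule step.simps)
next
  case Push show ?case unfolding cost.simps eval_lf.simps by (rule ev_step1, rule step.simps)
next
  case Pop show ?case unfolding cost.simps eval_lf.simps by (rule ev_step1, rule step.simps)
next
  case Query show ?case unfolding cost.simps eval_lf.simps by (rule ev_step1, rule step.simps)
qed simp_all

lemma ev_loop_freeI:
  assumes "loop_free p" "eval_lf f p s = s'" "cost p \<le> T"
  shows "ev f p s s' T"
  using ev_mono[OF ev_loop_free[OF assms(1)] assms(3)] assms(2) by auto

text \<open>The loop invariant is given as the explicit sequence of stores \<open>S j\<close>. Each
  round pays one extra step for the test, and the final failing test gives the
  \<open>+ 1\<close>.\<close>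

lemma ev_While_family:
  assumes "\<And>j. j < n \<Longrightarrow> S j i \<noteq> []" "S n i = []"
    and "\<And>j. j < n \<Longrightarrow> ev f p (S j) (S (Suc j)) T"
  shows "ev f (While i p) (S 0) (S n) (n * Suc T + 1)"
  using assms
proof (induction n arbitrary: S)
  case 0
  then show ?case by (intro ev_While_Nil) auto
next
  case (Suc n)
  have "ev f (While i p) (S (Suc 0)) (S (Suc n)) (n * Suc T + 1)"
    using Suc.IH[of "\<lambda>j. S (Suc j)"] Suc.prems by auto
  then have "ev f (While i p) (S 0) (S (Suc n)) (Suc (T + (n * Suc T + 1)))"
    using Suc.prems by (intro ev_While_step) auto
  then show ?case by (rule ev_mono) simp
qed


section \<open>Programs for binary arithmetic\<close>

abbreviation val :: "bool list \<Rightarrow> nat" where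
  "val \<equiv> horner_sum of_bool 2"

text \<open>Truth is encoded as nonemptiness because that is all \<open>While\<close> can test.
  Moreover \<open>[True]\<close> is the accepting content of stack 0.\<close>

definition flag :: "bool \<Rightarrow> bool list" where
  "flag b = (if b then [True] else [])"

lemma flag_simps [simp]: "flag True = [True]" "flag False = []"
  by (simp_all add: flag_def)

definition pour :: "nat \<Rightarrow> nat \<Rightarrow> prog" where
  "pour i j = While i (block [Branch i (Push j True) (Push j False) Skip, Pop i])"

lemma ev_pour:
  assumes "i \<noteq> j"
  shows "ev f (pour i j) s (s(i := [], j := rev (s i) @ s j)) (6 * length (s i) + 1)"
proof (induction "s i" arbitrary: s)
  case Nil
  show ?case unfolding pour_def by (intro ev_While_Nil) (use Nil[symmetric] in auto)
next
  case (Cons b bs)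
  let ?s = "s(j := b # s j, i := bs)"
  have 1: "ev f (block [Branch i (Push j True) (Push j False) Skip, Pop i]) s ?s 5"
    by (rule ev_loop_freeI) (use assms Cons(2)[symmetric] in \<open>auto simp: fun_eq_iff\<close>)
  have 2: "ev f (pour i j) ?s (?s(i := [], j := rev (?s i) @ ?s j)) (6 * length (?s i) + 1)"
    by (rule Cons(1)) simp
  have "ev f (pour i j) s (?s(i := [], j := rev (?s i) @ ?s j)) (Suc (5 + (6 * length (?s i) + 1)))"
    unfolding pour_def
    by (rule ev_While_step[OF _ 1 2[unfolded pour_def]]) (use Cons(2) in auto)
  moreover have "?s(i := [], j := rev (?s i) @ ?s j) = s(i := [], j := rev (s i) @ s j)"
    using assms Cons(2)[symmetric] by (auto simp: fun_eq_iff)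
  ultimately show ?case
    using assms Cons(2)[symmetric] by simp
qed

definition clear :: "nat \<Rightarrow> prog" where
  "clear i = While i (Pop i)"

lemma ev_clear: "ev f (clear i) s (s(i := [])) (2 * length (s i) + 1)"
proof (induction "s i" arbitrary: s)
  case Nil
  show ?case unfolding clear_def by (intro ev_While_Nil) (use Nil[symmetric] in auto)
next
  case (Cons b bs)
  let ?s = "s(i := bs)"
  have 1: "ev f (Pop i) s ?s 1"
    by (rule ev_loop_freeI) (use Cons(2)[symmetric] in auto)
  have 2: "ev f (clear i) ?s (?s(i := [])) (2 * length (?s i) + 1)"
    by (rule Cons(1)) simp
  have "ev f (clear i) s (?s(i := [])) (Suc (1 + (2 * length (?s i) + 1)))"
    unfolding clear_def
    by (rule ev_While_step[OF _ 1 2[unfolded clear_def]]) (use Cons(2) in auto)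
  then show ?case
    using Cons(2)[symmetric] by simp
qed

section \<open>Binary addition\<close>

definition add_bit0 :: "nat \<Rightarrow> nat \<Rightarrow> nat \<Rightarrow> prog" where
  "add_bit0 acc r c = block [Pop acc, Branch c (block [Push r True, Pop c]) Skip (Push r False)]"

definition add_bit1 :: "nat \<Rightarrow> nat \<Rightarrow> nat \<Rightarrow> prog" where
  "add_bit1 acc r c = block [Pop acc, Branch c (Push r False) Skip (Push r True)]"

definition add_bit2 :: "nat \<Rightarrow> nat \<Rightarrow> nat \<Rightarrow> prog" where
  "add_bit2 acc r c = block [Pop acc, Branch c (Push r True) Skip (block [Push r False, Push c True])]"

text \<open>The index in \<open>add_bit0\<close>, \<open>add_bit1\<close>, \<open>add_bit2\<close>
  is the sum of the two summand bits; the carry on \<open>c\<close> comes on top. An exhausted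
  \<open>acc\<close> reads as zeros, since popping an empty stack leaves it empty. The stack
  \<open>yt\<close> keeps the consumed bits so that \<open>y\<close> can be restored.\<close>

definition add_body :: "nat \<Rightarrow> nat \<Rightarrow> nat \<Rightarrow> nat \<Rightarrow> nat \<Rightarrow> prog" where
  "add_body acc y r yt c = Branch y
     (block [Pop y, Push yt True, Branch acc (add_bit2 acc r c) (add_bit1 acc r c) (add_bit1 acc r c)])
     (block [Pop y, Push yt False, Branch acc (add_bit1 acc r c) (add_bit0 acc r c) (add_bit0 acc r c)])
     Skip"

lemma ev_add_body:
  assumes "distinct [acc, y, r, yt, c]" "s y = b # bs" "s c = flag d"
  shows "\<exists>A e h. length A \<le> length (s acc) \<and>
    of_bool e + 2 * (val A + of_bool h) = val (s acc) + of_bool b + of_bool d \<and>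
    ev f (add_body acc y r yt c) s
      (s(y := bs, yt := b # s yt, r := e # s r, acc := A, c := flag h)) 20"
proof -
  define x where "x = (s acc \<noteq> [] \<and> hd (s acc))"
  define e where "e = (odd (of_bool x + of_bool b + of_bool d :: nat))"
  define h where "h = (of_bool x + of_bool b + of_bool d \<ge> (2::nat))"
  have l: "length (tl (s acc)) \<le> length (s acc)" by simp
  have v: "of_bool e + 2 * (val (tl (s acc)) + of_bool h) = val (s acc) + of_bool b + of_bool d"
    by (cases "s acc") (auto simp: e_def h_def x_def)
  have "ev f (add_body acc y r yt c) s
      (s(y := bs, yt := b # s yt, r := e # s r, acc := tl (s acc), c := flag h)) 20"
  proof (rule ev_loop_freeI)
    show "eval_lf f (add_body acc y r yt c) s
      = s(y := bs, yt := b # s yt, r := e # s r, acc := tl (s acc), c := flag h)"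
      by (insert assms, unfold distinct.simps list.set insert_iff empty_iff HOL.simp_thms de_Morgan_disj,
          elim conjE, cases b; cases d; cases "s acc"; rule ext)
        (simp_all add: add_body_def add_bit0_def add_bit1_def add_bit2_def e_def h_def x_def)
  qed (simp_all add: add_body_def add_bit0_def add_bit1_def add_bit2_def)
  with l v show ?thesis by blast
qed

definition add_carry :: "nat \<Rightarrow> nat \<Rightarrow> nat \<Rightarrow> prog" where
  "add_carry acc r c = Branch acc
     (block [Pop acc, Push r False])
     (block [Pop acc, Push r True, Pop c])
     (block [Push r True, Pop c])"

text \<open>Full-adder invariant: \<open>R\<close> holds the finished low-order digits, and what
  remains of the accumulator plus the carry counts with weight \<open>2 ^ length R\<close>.\<close>

lemma ev_add_loop1:
  assumes "distinct [acc, y, r, yt, c]" "s c = flag d"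
  shows "\<exists>R A h. length R = length (s y) \<and> length A \<le> length (s acc) \<and>
    val R + 2 ^ length R * (val A + of_bool h) = val (s acc) + val (s y) + of_bool d \<and>
    ev f (While y (add_body acc y r yt c)) s
      (s(y := [], yt := rev (s y) @ s yt, r := rev R @ s r, acc := A, c := flag h))
      (21 * length (s y) + 1)"
  using assms(2)
proof (induction "s y" arbitrary: s d)
  case Nil
  have "ev f (While y (add_body acc y r yt c)) s (s(y := [], yt := rev (s y) @ s yt,
      r := rev [] @ s r, acc := s acc, c := flag d)) (21 * length (s y) + 1)"
    by (intro ev_While_Nil) (use Nil(1)[symmetric] Nil(2) in \<open>auto simp: fun_eq_iff\<close>)
  with Nil(1)[symmetric] show ?case
    by (intro exI[of _ "[]"] exI[of _ "s acc"] exI[of _ d]) (simp del: fun_upd_apply)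
next
  case (Cons b bs)
  obtain A e h where 1: "length A \<le> length (s acc)"
    "of_bool e + 2 * (val A + of_bool h) = val (s acc) + of_bool b + of_bool d"
    "ev f (add_body acc y r yt c) s
      (s(y := bs, yt := b # s yt, r := e # s r, acc := A, c := flag h)) 20"
    using ev_add_body[OF assms(1) Cons(2)[symmetric] Cons(3)] by metis
  let ?s = "s(y := bs, yt := b # s yt, r := e # s r, acc := A, c := flag h)"
  have "bs = ?s y" "?s c = flag h" using assms(1) by auto
  from Cons(1)[where s = ?s and d = h, OF this] obtain R A' h' where 2: "length R = length (?s y)"
    "length A' \<le> length (?s acc)"
    "val R + 2 ^ length R * (val A' + of_bool h') = val (?s acc) + val (?s y) + of_bool h"
    "ev f (While y (add_body acc y r yt c)) ?s
      (?s(y := [], yt := rev (?s y) @ ?s yt, r := rev R @ ?s r, acc := A', c := flag h'))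
      (21 * length (?s y) + 1)" by auto
  have 3: "?s y = bs" "?s acc = A" using assms(1) by auto
  have "ev f (While y (add_body acc y r yt c)) s
      (?s(y := [], yt := rev (?s y) @ ?s yt, r := rev R @ ?s r, acc := A', c := flag h'))
      (Suc (20 + (21 * length (?s y) + 1)))"
    by (rule ev_While_step[OF _ 1(3) 2(4)]) (use Cons(2) in auto)
  moreover have "?s(y := [], yt := rev (?s y) @ ?s yt, r := rev R @ ?s r, acc := A', c := flag h')
     = s(y := [], yt := rev (s y) @ s yt, r := rev (e # R) @ s r, acc := A', c := flag h')"
    using assms(1) Cons(2)[symmetric] by (auto simp: fun_eq_iff)
  moreover have "val (e # R) + 2 ^ length (e # R) * (val A' + of_bool h')
     = val (s acc) + val (s y) + of_bool d"
    using 1(2) 2(3) 3 Cons(2)[symmetric] by (simp add: algebra_simps)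
  moreover have "Suc (20 + (21 * length (?s y) + 1)) = 21 * length (s y) + 1"
    using 3 Cons(2)[symmetric] by simp
  ultimately show ?case
    using 1 2 3 Cons(2)[symmetric]
    by (intro exI[of _ "e # R"] exI[of _ A'] exI[of _ h']) auto
qed

text \<open>A carry ripples on exactly while it meets a \<open>True\<close>, and each such round
  shortens \<open>acc\<close>. In all other cases it is absent or is absorbed in one round.\<close>

lemma ev_add_loop2:
  assumes "distinct [acc, r, c]" "s c = flag d"
  shows "\<exists>R A. length R + length A \<le> length (s acc) + 1 \<and>
    val (R @ A) = val (s acc) + of_bool d \<and>
    ev f (While c (add_carry acc r c)) s
      (s(r := rev R @ s r, acc := A, c := [])) (8 * length (s acc) + 9)"
  using assms(2)
proof (induction "length (s acc)" arbitrary: s d rule: less_induct)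
  case less
  show ?case
  proof (cases "d \<and> s acc \<noteq> [] \<and> hd (s acc)")
    case False
    define R where "R = (if d then [True] else [])"
    define A where "A = (if d then tl (s acc) else s acc)"
    have "ev f (While c (add_carry acc r c)) s (s(r := rev R @ s r, acc := A, c := [])) 9"
    proof (cases d)
      case True
      have "ev f (add_carry acc r c) s (s(r := rev R @ s r, acc := A, c := [])) 7"
      proof (rule ev_loop_freeI)
        show "eval_lf f (add_carry acc r c) s = s(r := rev R @ s r, acc := A, c := [])"
          by (insert assms(1) less.prems False True, cases "s acc"; rule ext) (simp_all add: add_carry_def R_def A_def)
      qed (simp_all add: add_carry_def)
      from ev_While_step[OF _ this ev_While_Nil[OF _ refl order_refl]]
      have "ev f (While c (add_carry acc r c)) s (s(r := rev R @ s r, acc := A, c := []))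
         (Suc (7 + 1))"
        using less.prems True by simp
      then show ?thesis by simp
    next
      case 2: False
      with less.prems show ?thesis
        by (intro ev_While_Nil) (auto simp: fun_eq_iff R_def A_def)
    qed
    moreover have "val (R @ A) = val (s acc) + of_bool d" "length R + length A \<le> length (s acc) + 1"
      using False by (cases "s acc"; simp add: R_def A_def)+
    ultimately show ?thesis
      by (intro exI[of _ R] exI[of _ A]) (auto intro: ev_mono)
  next
    case True
    then obtain as where as: "s acc = True # as" by (cases "s acc") auto
    let ?s = "s(r := False # s r, acc := as)"
    have 1: "ev f (add_carry acc r c) s ?s 7"
      using assms(1) as by (intro ev_loop_freeI) (auto simp: add_carry_def fun_eq_iff)
    have "length (?s acc) < length (s acc)" "?s c = flag True"
      using as assms(1) less.prems True by auto
    from less.hyps[where s = ?s and d = True, OF this] obtain R A where 2: "length R + length A \<le> length (?s acc) + 1"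
      "val (R @ A) = val (?s acc) + of_bool True"
      "ev f (While c (add_carry acc r c)) ?s
      (?s(r := rev R @ ?s r, acc := A, c := [])) (8 * length (?s acc) + 9)" by auto
    have 3: "?s acc = as" by simp
    have "ev f (While c (add_carry acc r c)) s
      (?s(r := rev R @ ?s r, acc := A, c := [])) (Suc (7 + (8 * length (?s acc) + 9)))"
      by (rule ev_While_step[OF _ 1 2(3)]) (use less.prems True in auto)
    moreover have "?s(r := rev R @ ?s r, acc := A, c := []) =
        s(r := rev (False # R) @ s r, acc := A, c := [])"
      using assms(1) by (auto simp: fun_eq_iff)
    ultimately show ?thesis
      using 2(1,2) as True
      by (intro exI[of _ "False # R"] exI[of _ A]) (auto simp: algebra_simps)
  qed
qed

definition add :: "nat \<Rightarrow> nat \<Rightarrow> nat \<Rightarrow> nat \<Rightarrow> nat \<Rightarrow> prog" where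
  "add acc y r yt c = block [While y (add_body acc y r yt c), While c (add_carry acc r c),
     pour r acc, pour yt y]"

text \<open>Leading zeros make the representation ambiguous, so the sum is fixed only by its value
  and a length bound. That \<open>y\<close> and the scratch stacks return to their old content is
  what lets \<open>mul\<close> call this in every round.\<close>

lemma ev_add:
  assumes "distinct [acc, y, r, yt, c]" "s c = []" "s r = []" "s yt = []"
  shows "\<exists>z. length z \<le> length (s acc) + length (s y) + 1 \<and> val z = val (s acc) + val (s y) \<and>
    ev f (add acc y r yt c) s (s(acc := z)) (50 * (length (s acc) + length (s y) + 1))"
proof -
  obtain R A h where 1: "length R = length (s y)" "length A \<le> length (s acc)"
    "val R + 2 ^ length R * (val A + of_bool h) = val (s acc) + val (s y)"
    "ev f (While y (add_body acc y r yt c)) s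
      (s(y := [], yt := rev (s y) @ s yt, r := rev R @ s r, acc := A, c := flag h))
      (21 * length (s y) + 1)"
    using ev_add_loop1[OF assms(1), of s False f] assms(2) by auto
  let ?s1 = "s(y := [], yt := rev (s y) @ s yt, r := rev R @ s r, acc := A, c := flag h)"
  have s1: "?s1 acc = A" "?s1 c = flag h" "distinct [acc, r, c]" using assms(1) by auto
  obtain R' A' where 2: "length R' + length A' \<le> length A + 1"
    "val (R' @ A') = val A + of_bool h"
    "ev f (While c (add_carry acc r c)) ?s1
      (?s1(r := rev R' @ ?s1 r, acc := A', c := [])) (8 * length A + 9)"
    using ev_add_loop2[where s = ?s1 and d = h and f = f, OF s1(3,2)] s1(1) by auto
  let ?s2 = "?s1(r := rev R' @ ?s1 r, acc := A', c := [])"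
  have s2: "?s2 r = rev R' @ rev R" "?s2 acc = A'" "?s2 yt = rev (s y)" "?s2 y = []" "r \<noteq> acc" "yt \<noteq> y"
    using assms by auto
  have 3: "ev f (pour r acc) ?s2 (?s2(r := [], acc := R @ R' @ A')) (6 * (length R + length R') + 1)"
    using ev_pour[OF s2(5), of f ?s2, unfolded s2(1,2)] by (simp add: add.commute)
  let ?s3 = "?s2(r := [], acc := R @ R' @ A')"
  have s3: "?s3 yt = rev (s y)" "?s3 y = []"
    using assms by auto
  have 4: "ev f (pour yt y) ?s3 (?s3(yt := [], y := s y)) (6 * length (s y) + 1)"
    using ev_pour[OF s2(6), of f ?s3, unfolded s3] by simp
  have "?s3(yt := [], y := s y) = s(acc := R @ R' @ A')"
    using assms by (auto simp: fun_eq_iff)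
  note 4 = 4[unfolded this]
  have "ev f (add acc y r yt c) s (s(acc := R @ R' @ A'))
    (Suc ((21 * length (s y) + 1) + Suc ((8 * length A + 9) +
       Suc ((6 * (length R + length R') + 1) + (6 * length (s y) + 1)))))"
    unfolding add_def block.simps by (rule ev_Seq[OF 1(4) ev_Seq[OF 2(3) ev_Seq[OF 3 4]]])
  then have "ev f (add acc y r yt c) s (s(acc := R @ R' @ A')) (50 * (length (s acc) + length (s y) + 1))"
    by (rule ev_mono) (use 1(1,2) 2(1) in simp)
  moreover have "val (R @ R' @ A') = val (s acc) + val (s y)"
    using 1(3) 2(2) by (simp add: horner_sum_append)
  ultimately show ?thesis using 1(1,2) 2(1) by (intro exI[of _ "R @ R' @ A'"]) auto
qed


section \<open>Multiplication by Horner's scheme\<close>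

definition mul_body :: "nat \<Rightarrow> nat \<Rightarrow> nat \<Rightarrow> nat \<Rightarrow> nat \<Rightarrow> nat \<Rightarrow> prog" where
  "mul_body x y acc r yt c =
     block [Push acc False, Branch x (block [Pop x, add acc y r yt c]) (Pop x) Skip]"

text \<open>The multiplier is stored with its most significant bit on top, unlike all other numbers.\<close>

definition mul :: "nat \<Rightarrow> nat \<Rightarrow> nat \<Rightarrow> nat \<Rightarrow> nat \<Rightarrow> nat \<Rightarrow> prog" where
  "mul x y acc r yt c = While x (mul_body x y acc r yt c)"

text \<open>With the least significant bit on top, pushing \<open>False\<close> doubles the
  accumulator. This is the Horner step, followed by a conditional addition of the
  multiplicand.\<close>

lemma ev_mul_body:
  assumes "distinct [x, y, acc, r, yt, c]" "s c = []" "s r = []" "s yt = []" "s x = b # bs"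
  shows "\<exists>z. length z \<le> length (s acc) + length (s y) + 2 \<and>
    val z = 2 * val (s acc) + of_bool b * val (s y) \<and>
    ev f (mul_body x y acc r yt c) s (s(x := bs, acc := z)) (50 * (length (s acc) + length (s y) + 2) + 10)"
proof -
  let ?s1 = "s(acc := False # s acc)"
  let ?s2 = "s(acc := False # s acc, x := bs)"
  have 1: "ev f (Push acc False) s ?s1 1"
    by (rule ev_loop_freeI) auto
  have 2: "ev f (Pop x) ?s1 ?s2 1"
    by (rule ev_loop_freeI) (use assms in auto)
  have top: "?s1 x = b # bs" using assms by auto
  show ?thesis
  proof (cases b)
    case False
    have "ev f (mul_body x y acc r yt c) s ?s2 (Suc (1 + Suc 1))"
      unfolding mul_body_def block.simps
      by (rule ev_Seq[OF 1 ev_Branch]) (use top False 2 in simp)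
    moreover have "?s2 = s(x := bs, acc := False # s acc)"
      using assms(1) by (auto simp: fun_eq_iff)
    ultimately show ?thesis
      using False by (intro exI[of _ "False # s acc"]) (auto intro: ev_mono)
  next
    case True
    have s2: "?s2 c = []" "?s2 r = []" "?s2 yt = []" "?s2 acc = False # s acc" "?s2 y = s y"
      and d: "distinct [acc, y, r, yt, c]" and tw: "\<And>z. ?s2(acc := z) = s(x := bs, acc := z)"
      using assms by (auto simp: fun_eq_iff)
    obtain z where z: "length z \<le> length (?s2 acc) + length (?s2 y) + 1"
      "val z = val (?s2 acc) + val (?s2 y)"
      "ev f (add acc y r yt c) ?s2 (?s2(acc := z)) (50 * (length (?s2 acc) + length (?s2 y) + 1))"
      using ev_add[OF d s2(1-3), of f] by blast
    have "ev f (Branch x (block [Pop x, add acc y r yt c]) (Pop x) Skip) ?s1 (?s2(acc := z))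
       (Suc (Suc (1 + 50 * (length (?s2 acc) + length (?s2 y) + 1))))"
      by (rule ev_Branch) (use top True ev_Seq[OF 2 z(3)] in simp)
    from ev_Seq[OF 1 this]
    have "ev f (mul_body x y acc r yt c) s (s(x := bs, acc := z))
       (50 * (length (s acc) + length (s y) + 2) + 10)"
      unfolding mul_body_def block.simps tw by (rule ev_mono) (use s2 in simp)
    then show ?thesis
      using z(1,2) True unfolding s2 by (intro exI[of _ z]) auto
  qed
qed

text \<open>A round lengthens the accumulator by at most \<open>length (s y) + 2\<close>, so its
  length plus that amount for each remaining round never grows. This lets one \<open>B\<close> bound
  all intermediate lengths and the cost of every round.\<close>

lemma ev_mul:
  assumes "distinct [x, y, acc, r, yt, c]" "s c = []" "s r = []" "s yt = []"
    "length (s acc) + length (s x) * (length (s y) + 2) \<le> B"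
  shows "\<exists>z. length z \<le> B \<and> val z = 2 ^ length (s x) * val (s acc) + val (rev (s x)) * val (s y) \<and>
    ev f (mul x y acc r yt c) s (s(x := [], acc := z))
      (length (s x) * (50 * (B + length (s y) + 2) + 11) + 1)"
  using assms(2-)
proof (induction "s x" arbitrary: s)
  case Nil
  have "ev f (mul x y acc r yt c) s (s(x := [], acc := s acc)) 1"
    unfolding mul_def by (intro ev_While_Nil) (use Nil(1)[symmetric] in auto)
  then show ?case using Nil(1)[symmetric] Nil(5)
    by (intro exI[of _ "s acc"]) (simp del: fun_upd_apply)
next
  case (Cons b bs)
  obtain z where 1: "length z \<le> length (s acc) + length (s y) + 2"
    "val z = 2 * val (s acc) + of_bool b * val (s y)"
    "ev f (mul_body x y acc r yt c) s (s(x := bs, acc := z))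
      (50 * (length (s acc) + length (s y) + 2) + 10)"
    using ev_mul_body[OF assms(1) Cons(3-5) Cons(2)[symmetric]] by blast
  let ?s = "s(x := bs, acc := z)"
  have s: "bs = ?s x" "?s c = []" "?s r = []" "?s yt = []" "?s y = s y" "?s acc = z"
    using assms(1) Cons(3-5) by auto
  have len: "length (?s acc) + length (?s x) * (length (?s y) + 2) \<le> B"
    using Cons(6) 1(1) unfolding s(5,6) s(1)[symmetric] Cons(2)[symmetric] by simp
  have le: "length (s acc) \<le> B" using Cons(6) by simp
  obtain z' where 2: "length z' \<le> B"
    "val z' = 2 ^ length (?s x) * val (?s acc) + val (rev (?s x)) * val (?s y)"
    "ev f (mul x y acc r yt c) ?s (?s(x := [], acc := z'))
      (length (?s x) * (50 * (B + length (?s y) + 2) + 11) + 1)"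
    using Cons(1)[OF s(1-4) len] by blast
  have "ev f (mul x y acc r yt c) s (?s(x := [], acc := z'))
    (Suc (50 * (length (s acc) + length (s y) + 2) + 10 +
       (length (?s x) * (50 * (B + length (?s y) + 2) + 11) + 1)))"
    unfolding mul_def by (rule ev_While_step[OF _ 1(3) 2(3)[unfolded mul_def]]) (use Cons(2) in auto)
  moreover have "?s(x := [], acc := z') = s(x := [], acc := z')"
    by (auto simp: fun_eq_iff)
  ultimately have "ev f (mul x y acc r yt c) s (s(x := [], acc := z'))
      (length (s x) * (50 * (B + length (s y) + 2) + 11) + 1)"
    using le unfolding s(5) s(1)[symmetric] Cons(2)[symmetric] by (auto elim!: ev_mono)
  moreover have "val z' = 2 ^ length (s x) * val (s acc) + val (rev (s x)) * val (s y)"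
    using 2(2) 1(2) unfolding s(5,6) s(1)[symmetric] Cons(2)[symmetric]
    by (simp add: horner_sum_append algebra_simps)
  ultimately show ?case using 2(1) by blast
qed

section \<open>Comparison of binary numbers\<close>

definition cmp_body1 :: "nat \<Rightarrow> nat \<Rightarrow> nat \<Rightarrow> prog" where
  "cmp_body1 x y r = Branch x
       (block [Pop x, Branch y (Pop y) (block [Pop y, Pop r]) (Pop r)])
       (block [Pop x, Branch y (block [Pop y, Pop r, Push r True]) (Pop y) Skip])
       Skip"

definition cmp_body2 :: "nat \<Rightarrow> nat \<Rightarrow> prog" where
  "cmp_body2 y r = Branch y (block [Pop y, Pop r, Push r True]) (Pop y) Skip"

definition cmp :: "nat \<Rightarrow> nat \<Rightarrow> nat \<Rightarrow> prog" where
  "cmp x y r = block [While x (cmp_body1 x y r), While y (cmp_body2 y r)]"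

text \<open>The bits arrive from the least significant end, so the flag records the verdict on the
  digits already seen and decides only if the rest ties: \<open>x < y + of_bool b\<close> says
  \<open>x < y\<close>, or \<open>x = y\<close> and \<open>b\<close>. When \<open>x\<close> is
  exhausted the rest of it counts as zero.\<close>

lemma ev_cmp_loop1:
  assumes "distinct [x, y, r]" "s r = flag b"
  shows "\<exists>Y d. length Y \<le> length (s y) \<and>
    (val (s x) < val (s y) + of_bool b \<longleftrightarrow> 0 < val Y + of_bool d) \<and>
    ev f (While x (cmp_body1 x y r)) s (s(x := [], y := Y, r := flag d)) (20 * length (s x) + 1)"
    (is "\<exists>Y d. _ \<and> _ \<and> ev f ?L _ _ _")
  using assms(2)
proof (induction "s x" arbitrary: s b)
  case Nil
  have "ev f ?L s (s(x := [], y := s y, r := flag b)) 1"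
    by (intro ev_While_Nil) (use Nil(1)[symmetric] Nil(2) in auto)
  then show ?case using Nil(1)[symmetric]
    by (intro exI[of _ "s y"] exI[of _ b]) (simp del: fun_upd_apply)
next
  case (Cons a as)
  define e where "e = (s y \<noteq> [] \<and> hd (s y))"
  \<comment> \<open>Differing bits override all less significant ones, and then the smaller number
    is the one with bit \<open>False\<close>.\<close>
  define h where "h = (if a = e then b else e)"
  let ?s = "s(x := as, y := tl (s y), r := flag h)"
  have neq: "x \<noteq> y" "x \<noteq> r" "y \<noteq> r" "y \<noteq> x" "r \<noteq> x" "r \<noteq> y"
    using assms(1) by auto
  have "eval_lf f (cmp_body1 x y r) s i = ?s i" for i
    using Cons(2)[symmetric] Cons(3) neq
    by (cases a; cases b; cases "s y") (auto simp: cmp_body1_def e_def h_def)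
  then have 1: "ev f (cmp_body1 x y r) s ?s 15"
    by (intro ev_loop_freeI ext) (auto simp: cmp_body1_def)
  have s: "as = ?s x" "?s r = flag h" "?s y = tl (s y)" using neq by auto
  from Cons(1)[where s = ?s and b = h, OF s(1,2)] obtain Y d where 2: "length Y \<le> length (?s y)"
    "val (?s x) < val (?s y) + of_bool h \<longleftrightarrow> 0 < val Y + of_bool d"
    "ev f ?L ?s (?s(x := [], y := Y, r := flag d)) (20 * length (?s x) + 1)"
    by (elim exE conjE) (rule that)
  have v: "val (s x) < val (s y) + of_bool b \<longleftrightarrow> val as < val (tl (s y)) + of_bool h"
    using Cons(2)[symmetric] by (cases "s y") (auto simp: e_def h_def)
  have "ev f ?L s (?s(x := [], y := Y, r := flag d)) (Suc (15 + (20 * length (?s x) + 1)))"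
    by (rule ev_While_step[OF _ 1 2(3)]) (use Cons(2) in auto)
  moreover have "?s(x := [], y := Y, r := flag d) = s(x := [], y := Y, r := flag d)"
    by (auto simp: fun_eq_iff)
  ultimately have "ev f ?L s (s(x := [], y := Y, r := flag d)) (20 * length (s x) + 1)"
    using Cons(2)[symmetric] s(1)[symmetric] by (auto elim!: ev_mono)
  moreover have "val (s x) < val (s y) + of_bool b \<longleftrightarrow> 0 < val Y + of_bool d"
    using v 2(2) unfolding s(3) s(1)[symmetric] by simp
  ultimately show ?case using 2(1) unfolding s(3) by (intro exI[of _ Y] exI[of _ d]) (simp del: fun_upd_apply)
qed

lemma ev_cmp_loop2:
  assumes "y \<noteq> r" "s r = flag b"
  shows "ev f (While y (cmp_body2 y r)) s
     (s(y := [], r := flag (0 < val (s y) + of_bool b))) (20 * length (s y) + 1)"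
    (is "ev f ?L _ _ _")
  using assms(2)
proof (induction "s y" arbitrary: s b)
  case Nil
  show ?case
    by (intro ev_While_Nil) (use Nil(1)[symmetric] Nil(2) in auto)
next
  case (Cons a as)
  let ?s = "s(y := as, r := flag (a \<or> b))"
  have "eval_lf f (cmp_body2 y r) s i = ?s i" for i
    using Cons(2)[symmetric] Cons(3) assms(1)
    by (cases a; cases b) (auto simp: cmp_body2_def)
  then have 1: "ev f (cmp_body2 y r) s ?s 15"
    by (intro ev_loop_freeI ext) (auto simp: cmp_body2_def)
  have s: "as = ?s y" "?s r = flag (a \<or> b)" using assms(1) by auto
  have "ev f ?L s (?s(y := [], r := flag (0 < val (?s y) + of_bool (a \<or> b))))
     (Suc (15 + (20 * length (?s y) + 1)))"
    by (rule ev_While_step[OF _ 1 Cons(1)[where s = ?s, OF s]]) (use Cons(2) in auto)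
  moreover have "?s(y := [], r := flag (0 < val (?s y) + of_bool (a \<or> b))) =
      s(y := [], r := flag (0 < val (s y) + of_bool b))"
    unfolding s(1)[symmetric] Cons(2)[symmetric] by (cases a) (auto simp: fun_eq_iff)
  ultimately show ?case
    unfolding s(1)[symmetric] Cons(2)[symmetric] by (auto elim!: ev_mono simp del: fun_upd_apply)
qed

lemma ev_cmp:
  assumes "distinct [x, y, r]" "s r = []"
  shows "ev f (cmp x y r) s (s(x := [], y := [], r := flag (val (s x) < val (s y))))
     (20 * (length (s x) + length (s y)) + 3)"
proof -
  obtain Y d where 1: "length Y \<le> length (s y)"
    "val (s x) < val (s y) \<longleftrightarrow> 0 < val Y + of_bool d"
    "ev f (While x (cmp_body1 x y r)) s (s(x := [], y := Y, r := flag d)) (20 * length (s x) + 1)"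
    using ev_cmp_loop1[OF assms(1), of s False f] assms(2) by auto
  let ?s = "s(x := [], y := Y, r := flag d)"
  have neq: "y \<noteq> r" "?s r = flag d" "?s y = Y" using assms(1) by auto
  have "ev f (cmp x y r) s (?s(y := [], r := flag (0 < val Y + of_bool d)))
      (Suc (20 * length (s x) + 1 + (20 * length Y + 1)))"
    unfolding cmp_def block.simps
    by (rule ev_Seq[OF 1(3) ev_cmp_loop2[where s = ?s and f = f, OF neq(1,2), unfolded neq(3)]])
  moreover have "?s(y := [], r := flag (0 < val Y + of_bool d)) =
      s(x := [], y := [], r := flag (val (s x) < val (s y)))"
    unfolding 1(2) using neq by (auto simp: fun_eq_iff)
  ultimately show ?thesis using 1(1) by (auto elim!: ev_mono)
qed


section \<open>Enumerating a truth table\<close>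

text \<open>Decrement with the least significant bit at the head, wrapping around at zero. Keeping
  the length fixed lets the counter itself serve as the query string.\<close>

fun decr :: "bool list \<Rightarrow> bool list" where
  "decr [] = []"
| "decr (True # xs) = False # xs"
| "decr (False # xs) = True # decr xs"

lemma length_decr [simp]: "length (decr xs) = length xs"
  by (induction xs rule: decr.induct) auto

lemma length_decr_funpow [simp]: "length ((decr ^^ n) xs) = length xs"
  by (induction n) auto

definition countdown :: "nat \<Rightarrow> bool list \<Rightarrow> bool list list" where
  "countdown n xs = map (\<lambda>j. (decr ^^ j) xs) [0..<n]"

lemma decr_funpow_double: "(decr ^^ (2 * j)) (True # xs) = True # (decr ^^ j) xs"
  by (induction j) auto

lemma countdown_double:
  "countdown (2 * n) (True # xs) =
     concat (map (\<lambda>ys. [True # ys, False # ys]) (countdown n xs))"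
proof (induction n)
  case (Suc n)
  have "countdown (2 * Suc n) (True # xs) =
    countdown (2 * n) (True # xs) @ [True # (decr ^^ n) xs, False # (decr ^^ n) xs]"
    by (simp add: countdown_def decr_funpow_double)
  then show ?case using Suc by (simp add: countdown_def)
qed (simp add: countdown_def)

text \<open>In \<open>n_lists\<close> the head varies fastest, as in binary counting with the low
  bit first, and counting down from all ones runs through this list backwards. The first
  \<open>2 ^ k\<close> values never borrow from the suffix \<open>zs\<close>.\<close>

lemma countdown_eq_n_lists:
  "countdown (2 ^ k) (replicate k True @ zs) =
     map (\<lambda>xs. xs @ zs) (rev (List.n_lists k [False, True]))"
proof (induction k)
  case (Suc k)
  have "countdown (2 ^ Suc k) (replicate (Suc k) True @ zs) =
    concat (map (\<lambda>ys. [True # ys, False # ys])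
      (map (\<lambda>xs. xs @ zs) (rev (List.n_lists k [False, True]))))"
    using countdown_double[of "2 ^ k" "replicate k True @ zs"] Suc by simp
  also have "\<dots> = map (\<lambda>xs. xs @ zs) (rev (List.n_lists (Suc k) [False, True]))"
    by (simp add: rev_concat rev_map map_concat comp_def)
  finally show ?case .
qed (simp add: countdown_def)

definition decr_body :: "nat \<Rightarrow> nat \<Rightarrow> nat \<Rightarrow> prog" where
  "decr_body q t e = Branch q (block [Pop q, Push q False, Pop e]) (block [Pop q, Push t True]) (Pop e)"

definition decr_prog :: "nat \<Rightarrow> nat \<Rightarrow> nat \<Rightarrow> prog" where
  "decr_prog q t e = block [Push e True,
     While e (decr_body q t e),
     pour t q]"

text \<open>The stack \<open>e\<close> is the pending borrow. The loop stops in the middle of the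
  number with the passed digits reversed on \<open>t\<close>, so only the reassembled
  \<open>rev x @ y\<close> is specified.\<close>

lemma ev_decr_loop:
  assumes "distinct [q, t, e]" "s e = [True]"
  shows "\<exists>x y. rev x @ y = rev (s t) @ decr (s q) \<and>
    ev f (While e (decr_body q t e))
      s (s(e := [], t := x, q := y)) (10 * length (s q) + 10)"
    (is "\<exists>x y. _ \<and> ev f ?L _ _ _")
  using assms(2)
proof (induction "s q" arbitrary: s)
  case Nil
  have neq: "q \<noteq> t" "q \<noteq> e" "t \<noteq> e" "t \<noteq> q" "e \<noteq> q" "e \<noteq> t" using assms(1) by auto
  have 1: "ev f (decr_body q t e) s
     (s(e := [])) 7"
    by (rule ev_loop_freeI) (use neq Nil(1)[symmetric] Nil(2) in \<open>simp_all add: decr_body_def\<close>)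
  have "ev f ?L s (s(e := [])) (Suc (7 + 1))"
    by (rule ev_While_step[OF _ 1 ev_While_Nil[OF _ refl order_refl]]) (use Nil in auto)
  then have "ev f ?L s (s(e := [])) (10 * length (s q) + 10)"
    by (rule ev_mono) simp
  moreover have "s(e := []) = s(e := [], t := s t, q := [])"
    using neq Nil(1)[symmetric] by (auto simp: fun_eq_iff)
  ultimately have "ev f ?L s (s(e := [], t := s t, q := [])) (10 * length (s q) + 10)" by simp
  then show ?case using Nil(1)[symmetric]
    by (intro exI[of _ "s t"] exI[of _ "[]"]) (simp del: fun_upd_apply)
next
  case (Cons b bs)
  have neq: "q \<noteq> t" "q \<noteq> e" "t \<noteq> e" "t \<noteq> q" "e \<noteq> q" "e \<noteq> t" using assms(1) by auto
  note Cons(2)[symmetric, simp]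
  show ?case
  proof (cases b)
    case True
    have 1: "ev f (decr_body q t e) s
       (s(e := [], q := False # bs)) 7"
      by (rule ev_loop_freeI) (use neq True Cons(3) in \<open>auto simp: decr_body_def fun_eq_iff\<close>)
    have "ev f ?L s (s(e := [], q := False # bs)) (Suc (7 + 1))"
      by (rule ev_While_step[OF _ 1 ev_While_Nil[OF _ refl order_refl]]) (use Cons(3) neq in auto)
    then have "ev f ?L s (s(e := [], q := False # bs)) (10 * length (s q) + 10)"
      by (rule ev_mono) simp
    moreover have "s(e := [], q := False # bs) = s(e := [], t := s t, q := False # bs)"
      using neq by (auto simp: fun_eq_iff)
    ultimately have "ev f ?L s (s(e := [], t := s t, q := False # bs)) (10 * length (s q) + 10)"
      by simp
    then show ?thesis using True
      by (intro exI[of _ "s t"] exI[of _ "False # bs"]) (simp del: fun_upd_apply)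
  next
    case False
    let ?s = "s(t := True # s t, q := bs)"
    have 1: "ev f (decr_body q t e) s
       ?s 7"
      by (rule ev_loop_freeI) (use neq False Cons(3) in \<open>auto simp: decr_body_def fun_eq_iff\<close>)
    have s: "bs = ?s q" "?s e = [True]" "?s t = True # s t" using neq Cons(3) by auto
    obtain x y where xy: "rev x @ y = rev (?s t) @ decr (?s q)"
      "ev f ?L ?s (?s(e := [], t := x, q := y)) (10 * length (?s q) + 10)"
      using Cons(1)[where s = ?s, OF s(1,2)] by (elim exE conjE) (rule that)
    have "ev f ?L s (?s(e := [], t := x, q := y)) (Suc (7 + (10 * length (?s q) + 10)))"
      by (rule ev_While_step[OF _ 1 xy(2)]) (use Cons(3) in auto)
    then have "ev f ?L s (?s(e := [], t := x, q := y)) (10 * length (s q) + 10)"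
      by (rule ev_mono) (use s(1)[symmetric] in simp)
    moreover have "?s(e := [], t := x, q := y) = s(e := [], t := x, q := y)"
      using neq by (auto simp: fun_eq_iff)
    ultimately have "ev f ?L s (s(e := [], t := x, q := y)) (10 * length (s q) + 10)"
      by simp
    moreover have "rev x @ y = rev (s t) @ decr (s q)"
      using xy(1) False unfolding s(3) s(1)[symmetric] by simp
    ultimately show ?thesis by (intro exI[of _ x] exI[of _ y]) (simp del: fun_upd_apply)
  qed
qed

lemma ev_decr:
  assumes "distinct [q, t, e]" "s e = []" "s t = []"
  shows "ev f (decr_prog q t e) s (s(q := decr (s q))) (20 * length (s q) + 20)"
proof -
  let ?s = "s(e := [True])"
  have s: "?s e = [True]" "?s t = []" "?s q = s q" "t \<noteq> q" using assms by auto
  obtain x y where xy: "rev x @ y = decr (s q)"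
      "ev f (While e (decr_body q t e))
        ?s (?s(e := [], t := x, q := y)) (10 * length (s q) + 10)"
    using ev_decr_loop[where s = ?s and f = f, OF assms(1) s(1), unfolded s(2,3)]
    unfolding rev.simps append.simps
    by (elim exE conjE) (rule that)
  let ?s2 = "?s(e := [], t := x, q := y)"
  have s2: "?s2 t = x" "?s2 q = y" using s by auto
  have len: "length x \<le> length (s q)" using xy(1) by (metis length_append length_decr length_rev le_add1)
  have 1: "ev f (Push e True) s ?s 1" by (rule ev_loop_freeI) (use assms in auto)
  have "ev f (decr_prog q t e) s (?s2(t := [], q := rev x @ y))
     (Suc (1 + Suc ((10 * length (s q) + 10) + (6 * length x + 1))))"
    unfolding decr_prog_def block.simps
    by (rule ev_Seq[OF 1 ev_Seq[OF xy(2) ev_pour[OF s(4), where s = ?s2, unfolded s2]]])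
  then have "ev f (decr_prog q t e) s (?s2(t := [], q := rev x @ y)) (20 * length (s q) + 20)"
    by (rule ev_mono) (use len in simp)
  moreover have "?s2(t := [], q := rev x @ y) = s(q := decr (s q))"
    using assms xy(1) by (auto simp: fun_eq_iff)
  ultimately show ?thesis by (simp del: fun_upd_apply)
qed

text \<open>The consumed unary counter \<open>l\<close> is copied to \<open>l'\<close>, since the
  same number of coins is needed later for the random table.\<close>

definition table_prog :: "nat \<Rightarrow> nat \<Rightarrow> nat \<Rightarrow> nat \<Rightarrow> nat \<Rightarrow> nat \<Rightarrow> prog" where
  "table_prog l q g l' t e =
     While l (block [block [Query q g, Push l' True, Pop l], decr_prog q t e])"

lemma ev_table:
  assumes "distinct [l, q, g, l', t, e]" "s e = []" "s t = []" "s l = replicate n True"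
  shows "ev f (table_prog l q g l' t e) s
    (s(l := [], q := (decr ^^ n) (s q), g := rev (map f (countdown n (s q))) @ s g,
       l' := replicate n True @ s l')) (n * (20 * length (s q) + 40) + 1)"
proof -
  define S where "S j = s(l := replicate (n - j) True, q := (decr ^^ j) (s q),
    g := rev (map f (countdown j (s q))) @ s g, l' := replicate j True @ s l')" for j
  have "s = S 0" using assms by (auto simp: S_def countdown_def)
  have neq: "l \<noteq> q" "l \<noteq> g" "l \<noteq> l'" "l \<noteq> t" "l \<noteq> e" "q \<noteq> g" "q \<noteq> l'" "q \<noteq> t" "q \<noteq> e"
     "g \<noteq> l'" "g \<noteq> t" "g \<noteq> e" "l' \<noteq> t" "l' \<noteq> e" "t \<noteq> e"
     "q \<noteq> l" "g \<noteq> l" "l' \<noteq> l" "t \<noteq> l" "e \<noteq> l" "g \<noteq> q" "l' \<noteq> q" "t \<noteq> q" "e \<noteq> q"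
     "l' \<noteq> g" "t \<noteq> g" "e \<noteq> g" "t \<noteq> l'" "e \<noteq> l'" "e \<noteq> t" using assms(1) by auto
  have SS: "S j l = replicate (n - j) True" "S j q = (decr ^^ j) (s q)" "S j e = []" "S j t = []"
    "S j g = rev (map f (countdown j (s q))) @ s g" "S j l' = replicate j True @ s l'" for j
    using neq assms by (simp_all add: S_def)
  have "ev f (While l (block [block [Query q g, Push l' True, Pop l], decr_prog q t e])) (S 0) (S n)
    (n * Suc (20 * length (s q) + 30) + 1)"
  proof (rule ev_While_family)
    fix j assume "j < n"
    then show "S j l \<noteq> []" using assms by (simp add: SS)
    let ?s = "(S j)(g := f (S j q) # S j g, l' := True # S j l', l := tl (S j l))"
    have 1: "ev f (block [Query q g, Push l' True, Pop l]) (S j) ?s 5"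
      by (rule ev_loop_freeI) (use neq in \<open>simp_all add: fun_eq_iff\<close>)
    have s: "?s e = []" "?s t = []" "?s q = (decr ^^ j) (s q)"
      using neq by (simp_all add: SS)
    have d: "distinct [q, t, e]" using neq by simp
    have "ev f (block [block [Query q g, Push l' True, Pop l], decr_prog q t e]) (S j)
      (?s(q := decr ((decr ^^ j) (s q)))) (Suc (5 + (20 * length (s q) + 20)))"
      unfolding block.simps(2)
      unfolding block.simps(3)[of "block [Query q g, Push l' True, Pop l]"] block.simps(2)
      using ev_Seq[OF 1 ev_decr[where s = ?s, OF d s(1,2), unfolded s(3)]] by simp
    then have "ev f (block [block [Query q g, Push l' True, Pop l], decr_prog q t e]) (S j)
      (?s(q := decr ((decr ^^ j) (s q)))) (20 * length (s q) + 30)"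
      by (rule ev_mono) simp
    moreover have "?s(q := decr ((decr ^^ j) (s q))) = S (Suc j)"
      using neq \<open>j < n\<close> unfolding SS
      by (auto simp: S_def fun_eq_iff countdown_def tl_replicate)
    ultimately show "ev f (block [block [Query q g, Push l' True, Pop l], decr_prog q t e]) (S j)
       (S (Suc j)) (20 * length (s q) + 30)" by simp
  qed (use neq in \<open>simp add: S_def\<close>)
  then have "ev f (table_prog l q g l' t e) s (S n) (n * (20 * length (s q) + 40) + 1)"
    unfolding table_prog_def \<open>s = S 0\<close>[symmetric] by (rule ev_mono) simp
  then show ?thesis by (simp add: S_def)
qed


section \<open>Unary arithmetic and oracle-independent sampling\<close>

definition double_prog :: "nat \<Rightarrow> nat \<Rightarrow> prog" where
  "double_prog l t = block [While l (block [Pop l, Push t True, Push t True]), pour t l]"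

lemma ev_double:
  assumes "l \<noteq> t" "s l = replicate n True" "s t = []"
  shows "ev f (double_prog l t) s (s(l := replicate (2 * n) True)) (20 * n + 10)"
proof -
  define S where "S j = s(l := replicate (n - j) True, t := replicate (2 * j) True)" for j
  have "ev f (While l (block [Pop l, Push t True, Push t True])) (S 0) (S n) (n * Suc 5 + 1)"
  proof (rule ev_While_family)
    fix j assume "j < n"
    then show "S j l \<noteq> []" using assms(1) by (simp add: S_def)
    show "ev f (block [Pop l, Push t True, Push t True]) (S j) (S (Suc j)) 5"
      by (rule ev_loop_freeI) (use assms(1) \<open>j < n\<close> in \<open>auto simp: S_def fun_eq_iff tl_replicate\<close>)
  qed (use assms(1) in \<open>simp add: S_def\<close>)
  moreover have "S 0 = s" using assms by (auto simp: S_def)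
  ultimately have 1: "ev f (While l (block [Pop l, Push t True, Push t True])) s (S n) (n * Suc 5 + 1)"
    by simp
  have S: "S n l = []" "S n t = replicate (2 * n) True" using assms(1) by (auto simp: S_def)
  have "ev f (double_prog l t) s ((S n)(t := [], l := rev (replicate (2 * n) True) @ []))
     (Suc ((n * Suc 5 + 1) + (6 * length (replicate (2 * n) True) + 1)))"
    unfolding double_prog_def block.simps(2) block.simps(3)[of _ "pour t l"]
    by (rule ev_Seq[OF 1 ev_pour[OF assms(1)[symmetric], where s = "S n", unfolded S]])
  moreover have "(S n)(t := [], l := rev (replicate (2 * n) True) @ []) = s(l := replicate (2 * n) True)"
    using assms by (auto simp: S_def fun_eq_iff)
  ultimately show ?thesis by (auto elim!: ev_mono)
qed

definition halve_body :: "nat \<Rightarrow> nat \<Rightarrow> prog" where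
  "halve_body m t = block [Pop m,
     Branch m (block [Pop m, Push t True]) (block [Pop m, Push t True]) Skip]"

definition halve_prog :: "nat \<Rightarrow> nat \<Rightarrow> prog" where
  "halve_prog m t = block [While m (halve_body m t), pour t m]"

lemma ev_halve:
  assumes "m \<noteq> t" "s m = replicate n True" "s t = []"
  shows "ev f (halve_prog m t) s (s(m := replicate (n div 2) True)) (20 * n + 20)"
proof -
  \<comment> \<open>For odd \<open>n\<close> the last round removes a single entry and pushes
    nothing, hence the rounded-up number \<open>h\<close> of rounds and the cap
    \<open>n div 2\<close>.\<close>
  define S where "S j = s(m := replicate (n - 2 * j) True, t := replicate (min j (n div 2)) True)" for j
  define h where "h = (n + 1) div 2"
  have "ev f (While m (halve_body m t)) (S 0) (S h) (h * Suc 6 + 1)"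
  proof (rule ev_While_family)
    fix j assume j: "j < h"
    then show "S j m \<noteq> []" using assms(1) by (simp add: S_def h_def)
    have "eval_lf f (halve_body m t) (S j) i = S (Suc j) i" for i
    proof (cases "n - 2 * j = 1")
      case True
      then have "n = Suc (2 * j)" by simp
      then show ?thesis using assms(1) by (simp add: S_def halve_body_def)
    next
      case False
      then obtain k where "n = 2 * j + Suc (Suc k)"
        using j unfolding h_def by (intro that[of "n - 2 * j - 2"]) linarith
      then show ?thesis using assms(1) by (simp add: S_def halve_body_def)
    qed
    then show "ev f (halve_body m t) (S j) (S (Suc j)) 6"
      by (intro ev_loop_freeI ext) (auto simp: halve_body_def)
  qed (use assms(1) in \<open>simp add: S_def h_def\<close>)
  moreover have "S 0 = s" using assms by (auto simp: S_def)
  ultimately have 1: "ev f (While m (halve_body m t)) s (S h) (h * Suc 6 + 1)"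
    by simp
  have S: "S h m = []" "S h t = replicate (n div 2) True"
    using assms(1) by (auto simp: S_def h_def min_def)
  have "ev f (halve_prog m t) s ((S h)(t := [], m := rev (replicate (n div 2) True) @ []))
     (Suc ((h * Suc 6 + 1) + (6 * length (replicate (n div 2) True) + 1)))"
    unfolding halve_prog_def block.simps(2) block.simps(3)[of _ "pour t m"]
    by (rule ev_Seq[OF 1 ev_pour[OF assms(1)[symmetric], where s = "S h", unfolded S]])
  moreover have "(S h)(t := [], m := rev (replicate (n div 2) True) @ []) = s(m := replicate (n div 2) True)"
    using assms by (auto simp: S_def fun_eq_iff)
  ultimately show ?thesis by (auto elim!: ev_mono simp: h_def)
qed

fun repeat_prog :: "nat \<Rightarrow> prog \<Rightarrow> prog" where
  "repeat_prog 0 p = Skip"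
| "repeat_prog (Suc n) p = Seq p (repeat_prog n p)"

lemma ev_repeat_double:
  assumes "l \<noteq> t" "s l = replicate a True" "s t = []" "a * 2 ^ K \<le> B"
  shows "ev f (repeat_prog K (double_prog l t)) s (s(l := replicate (a * 2 ^ K) True))
    (K * (20 * B + 11) + 1)"
  using assms
proof (induction K arbitrary: s a)
  case 0
  show ?case by (rule ev_loop_freeI) (use 0 in auto)
next
  case (Suc K)
  let ?s = "s(l := replicate (2 * a) True)"
  have s: "?s l = replicate (2 * a) True" "?s t = []" "2 * a * 2 ^ K \<le> B" using Suc.prems by auto
  have "a * 1 \<le> a * 2 ^ Suc K" by (intro mult_le_mono) auto
  then have le: "a \<le> B" using Suc.prems(4) by linarith
  from ev_Seq[OF ev_double[OF Suc.prems(1-3)] Suc.IH[where s = ?s, OF Suc.prems(1) s]]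
  have "ev f (repeat_prog (Suc K) (double_prog l t)) s
     (?s(l := replicate (2 * a * 2 ^ K) True)) (Suc K * (20 * B + 11) + 1)"
    unfolding repeat_prog.simps by (rule ev_mono) (use le in simp)
  moreover have "?s(l := replicate (2 * a * 2 ^ K) True) = s(l := replicate (a * 2 ^ Suc K) True)"
    by (simp add: mult_ac)
  ultimately show ?case by metis
qed

text \<open>The number of binary digits, in the recursion that the halving loop follows. It is a
  computable substitute for the logarithm.\<close>

fun bitlen :: "nat \<Rightarrow> nat" where
  "bitlen n = (if n = 0 then 0 else Suc (bitlen (n div 2)))"

declare bitlen.simps [simp del]

lemma bitlen_0 [simp]: "bitlen 0 = 0"
  by (simp add: bitlen.simps)

lemma less_power_bitlen: "n < 2 ^ bitlen n"
proof (induction n rule: bitlen.induct)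
  case (1 n)
  then show ?case by (cases "n = 0") (auto simp: bitlen.simps[of n])
qed

lemma power_bitlen_le: "n > 0 \<Longrightarrow> 2 ^ bitlen n \<le> 2 * n"
proof (induction n rule: bitlen.induct)
  case (1 n)
  show ?case
  proof (cases "n = 1")
    case True
    then show ?thesis by (simp add: bitlen.simps)
  next
    case False
    then have "2 ^ bitlen (n div 2) \<le> 2 * (n div 2)" using 1 by auto
    then show ?thesis using 1(2) by (simp add: bitlen.simps[of n])
  qed
qed

definition scale_prog :: "nat \<Rightarrow> nat \<Rightarrow> nat \<Rightarrow> nat \<Rightarrow> prog" where
  "scale_prog K m l t = While m (block [halve_prog m t, repeat_prog K (double_prog l t)])"

text \<open>Each halving of the counter multiplies the length of \<open>l\<close> by
  \<open>2 ^ K\<close>. The bounds \<open>B\<close> and \<open>N\<close> stay fixed while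
  \<open>a\<close> and \<open>n\<close> change, so that every round has the same cost
  estimate.\<close>

lemma ev_scale:
  assumes "distinct [m, l, t]" "s m = replicate n True" "s l = replicate a True" "s t = []"
    "a * 2 ^ (K * bitlen n) \<le> B" "n \<le> N"
  shows "ev f (scale_prog K m l t) s (s(m := [], l := replicate (a * 2 ^ (K * bitlen n)) True))
    (n * (20 * N + K * (20 * B + 11) + 30) + 1)"
  using assms(2-)
proof (induction n arbitrary: s a rule: less_induct)
  case (less n)
  have neq: "m \<noteq> l" "m \<noteq> t" "l \<noteq> t" "l \<noteq> m" using assms(1) by auto
  show ?case
  proof (cases "n = 0")
    case True
    then show ?thesis unfolding scale_prog_def using less.prems neq
      by (intro ev_While_Nil) (auto simp: fun_eq_iff)
  next
    case False
    let ?s1 = "s(m := replicate (n div 2) True)"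
    let ?s2 = "?s1(l := replicate (a * 2 ^ K) True)"
    have s1: "?s1 l = replicate a True" "?s1 t = []" using less.prems neq by auto
    have s2: "?s2 m = replicate (n div 2) True" "?s2 l = replicate (a * 2 ^ K) True" "?s2 t = []"
      using less.prems neq by auto
    have b: "a * 2 ^ K * 2 ^ (K * bitlen (n div 2)) = a * 2 ^ (K * bitlen n)"
      using False by (simp add: bitlen.simps[of n] power_add)
    have B: "a * 2 ^ K * 2 ^ (K * bitlen (n div 2)) \<le> B" unfolding b by (rule less.prems(4))
    have "a * 2 ^ K * 1 \<le> a * 2 ^ K * 2 ^ (K * bitlen (n div 2))"
      by (rule mult_le_mono2) simp
    then have B1: "a * 2 ^ K \<le> B" using B by linarith
    have N: "n div 2 \<le> N" using less.prems by simp
    have 1: "ev f (block [halve_prog m t, repeat_prog K (double_prog l t)]) s ?s2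
       (Suc (20 * n + 20 + (K * (20 * B + 11) + 1)))"
      unfolding block.simps
      by (rule ev_Seq[OF ev_halve[OF neq(2) less.prems(1,3)]
          ev_repeat_double[where s = ?s1, OF neq(3) s1 B1]])
    have "n div 2 < n" using False by simp
    note 2 = less.IH[where s = ?s2, OF this s2 B N]
    \<comment> \<open>Crude but polynomial: each round is charged to a unit of \<open>n\<close>,
      though there are only \<open>bitlen n\<close> rounds.\<close>
    have "n = Suc (n - 1)" "n div 2 \<le> n - 1" using False by auto
    then have "n * (20 * N + K * (20 * B + 11) + 30) \<ge>
       (n div 2) * (20 * N + K * (20 * B + 11) + 30) + (20 * N + K * (20 * B + 11) + 30)"
      by (metis add.commute mult_Suc mult_le_mono1 nat_add_left_cancel_le)
    then have "Suc (Suc (20 * n + 20 + (K * (20 * B + 11) + 1)) +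
       (n div 2 * (20 * N + K * (20 * B + 11) + 30) + 1))
      \<le> n * (20 * N + K * (20 * B + 11) + 30) + 1"
      using less.prems(5) by linarith
    note 3 = ev_mono[OF ev_While_step[where i = m, OF _ 1 2[unfolded scale_prog_def]] this]
    have "ev f (scale_prog K m l t) s
      (?s2(m := [], l := replicate (a * 2 ^ K * 2 ^ (K * bitlen (n div 2))) True))
      (n * (20 * N + K * (20 * B + 11) + 30) + 1)"
      unfolding scale_prog_def by (rule 3) (use less.prems(1) False in simp)
    moreover have "?s2(m := [], l := replicate (a * 2 ^ K * 2 ^ (K * bitlen (n div 2))) True)
       = s(m := [], l := replicate (a * 2 ^ (K * bitlen n)) True)"
      unfolding b using neq by (auto simp: fun_eq_iff)
    ultimately show ?thesis by metis
  qed
qed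

definition init_prog :: "nat \<Rightarrow> nat \<Rightarrow> nat \<Rightarrow> prog" where
  "init_prog i q m = While i (block [Pop i, Push q True, Push m True])"

lemma ev_init:
  assumes "distinct [i, q, m]" "s q = []" "s m = []"
  shows "ev f (init_prog i q m) s (s(i := [], q := replicate (length (s i)) True,
     m := replicate (length (s i)) True)) (6 * length (s i) + 1)"
proof -
  define n where "n = length (s i)"
  define S where "S j = s(i := drop j (s i), q := replicate j True, m := replicate j True)" for j
  have neq: "i \<noteq> q" "i \<noteq> m" "q \<noteq> m" "q \<noteq> i" "m \<noteq> i" "m \<noteq> q" using assms(1) by auto
  have "ev f (init_prog i q m) (S 0) (S n) (n * Suc 5 + 1)"
    unfolding init_prog_def
  proof (rule ev_While_family)
    fix j assume "j < n"
    then show "S j i \<noteq> []" using neq by (simp add: S_def n_def)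
    show "ev f (block [Pop i, Push q True, Push m True]) (S j) (S (Suc j)) 5"
      by (rule ev_loop_freeI) (use neq in \<open>auto simp: S_def fun_eq_iff tl_drop drop_Suc\<close>)
  qed (use neq in \<open>simp add: S_def n_def\<close>)
  moreover have "S 0 = s" using assms neq by (auto simp: S_def fun_eq_iff)
  ultimately show ?thesis by (auto simp: S_def n_def mult.commute elim!: ev_mono)
qed

section \<open>Sampling uniform bit strings\<close>

definition flip_prog :: "nat \<Rightarrow> nat \<Rightarrow> prog" where
  "flip_prog l h = While l (Seq (Pop l) (Flip h))"

definition bitstrings :: "nat \<Rightarrow> bool list set" where
  "bitstrings n = {xs. length xs = n}"

lemma bitstrings_eq_lists: "bitstrings n = {xs. set xs \<subseteq> UNIV \<and> length xs = n}"
  by (simp add: bitstrings_def)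

lemma finite_bitstrings [simp]: "finite (bitstrings n)"
  unfolding bitstrings_eq_lists by (rule finite_lists_length_eq) simp

lemma card_bitstrings [simp]: "card (bitstrings n) = 2 ^ n"
  unfolding bitstrings_eq_lists by (subst card_lists_length_eq) auto

lemma bitstrings_nonempty [simp]: "bitstrings n \<noteq> {}"
  using length_replicate[of n True] unfolding bitstrings_def by blast

text \<open>The new bit is appended at the end because the coin flipped first lies deepest in the
  stack.\<close>

lemma pmf_of_bitstrings_Suc:
  "pmf_of_set (bitstrings (Suc n)) =
     bind_pmf (pmf_of_set UNIV) (\<lambda>b. map_pmf (\<lambda>xs. xs @ [b]) (pmf_of_set (bitstrings n)))"
proof -
  have inj: "inj_on (\<lambda>(b, xs). xs @ [b]) (UNIV \<times> bitstrings n)" by (auto simp: inj_on_def)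
  have im: "(\<lambda>(b, xs). xs @ [b]) ` (UNIV \<times> bitstrings n) = bitstrings (Suc n)"
  proof (intro set_eqI iffI)
    fix x assume "x \<in> bitstrings (Suc n)"
    then have "x = butlast x @ [last x]" "butlast x \<in> bitstrings n"
      by (auto simp: bitstrings_def intro!: append_butlast_last_id[symmetric])
    then show "x \<in> (\<lambda>(b, xs). xs @ [b]) ` (UNIV \<times> bitstrings n)"
      by (intro image_eqI[of _ _ "(last x, butlast x)"]) auto
  qed (auto simp: bitstrings_def)
  have "pmf_of_set (bitstrings (Suc n)) =
      map_pmf (\<lambda>(b, xs). xs @ [b]) (pmf_of_set (UNIV \<times> bitstrings n))"
    using map_pmf_of_set_inj[OF inj] im by simp
  also have "pmf_of_set ((UNIV :: bool set) \<times> bitstrings n) = pair_pmf (pmf_of_set UNIV) (pmf_of_set (bitstrings n))"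
  proof (rule pmf_eqI)
    fix x :: "bool \<times> bool list"
    have "finite ((UNIV :: bool set) \<times> bitstrings n)" "(UNIV :: bool set) \<times> bitstrings n \<noteq> {}"
      by (auto simp del: UNIV_bool)
    then show "pmf (pmf_of_set (UNIV \<times> bitstrings n)) x =
        pmf (pair_pmf (pmf_of_set UNIV) (pmf_of_set (bitstrings n))) x"
      by (cases x) (simp add: pmf_pair indicator_def card_cartesian_product)
  qed
  finally show ?thesis
    by (simp add: pair_pmf_def map_bind_pmf map_pmf_def bind_assoc_pmf bind_return_pmf)
qed

lemma iter_flip:
  assumes "l \<noteq> h"
  shows "iter f (4 * length (s l) + 1) (flip_prog l h # ps, s) =
    map_pmf (\<lambda>xs. (ps, s(l := [], h := xs @ s h))) (pmf_of_set (bitstrings (length (s l))))"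
proof (induction "length (s l)" arbitrary: s)
  case 0
  have "bitstrings 0 = {[]}" by (auto simp: bitstrings_def)
  moreover have "s(l := [], h := [] @ s h) = s" using 0 by (auto simp: fun_eq_iff)
  ultimately show ?case using 0
    by (simp add: flip_prog_def iter_Suc bind_return_pmf pmf_of_set_singleton del: fun_upd_apply append.simps)
next
  case (Suc n)
  define s' where "s' b = s(l := tl (s l), h := b # s h)" for b
  have len: "n = length (s' b l)" and s': "s' b l = tl (s l)" "s' b h = b # s h" for b
    using Suc(2) assms by (auto simp: s'_def)
  \<comment> \<open>Four steps per coin: the loop test, the unfolding of \<open>Seq\<close>,
    \<open>Pop\<close> and \<open>Flip\<close>.\<close>
  have step: "iter f (Suc (Suc (Suc (Suc t)))) (flip_prog l h # ps, s) =
     bind_pmf (pmf_of_set UNIV) (\<lambda>b. iter f t (flip_prog l h # ps, s' b))" for t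
    using Suc(2) assms by (auto simp: flip_prog_def iter_Suc bind_return_pmf bind_map_pmf s'_def)
  have "4 * length (s l) + 1 = Suc (Suc (Suc (Suc (4 * n + 1))))" using Suc(2) by simp
  then have "iter f (4 * length (s l) + 1) (flip_prog l h # ps, s) =
     bind_pmf (pmf_of_set UNIV) (\<lambda>b. iter f (4 * n + 1) (flip_prog l h # ps, s' b))"
    by (simp only: step)
  also have "\<dots> = bind_pmf (pmf_of_set UNIV) (\<lambda>b. 
      map_pmf (\<lambda>xs. (ps, (s' b)(l := [], h := xs @ s' b h))) (pmf_of_set (bitstrings n)))"
    using Suc(1)[where s = "s' _", OF len] by (simp add: len[symmetric])
  also have "\<dots> = bind_pmf (pmf_of_set UNIV) (\<lambda>b. 
      map_pmf (\<lambda>xs. (ps, s(l := [], h := (xs @ [b]) @ s h))) (pmf_of_set (bitstrings n)))"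
    using assms by (intro bind_pmf_cong map_pmf_cong refl) (auto simp: s'_def fun_eq_iff)
  also have "\<dots> = map_pmf (\<lambda>xs. (ps, s(l := [], h := xs @ s h))) (pmf_of_set (bitstrings (Suc n)))"
    unfolding pmf_of_bitstrings_Suc map_bind_pmf by (simp add: pmf.map_comp comp_def)
  finally show ?case unfolding Suc(2) .
qed


section \<open>Subroutines\<close>

fun stack_bound :: "prog \<Rightarrow> nat" where
  "stack_bound Skip = 0"
| "stack_bound (Push i b) = Suc i"
| "stack_bound (Pop i) = Suc i"
| "stack_bound (Flip i) = Suc i"
| "stack_bound (Query q a) = Suc (max q a)"
| "stack_bound (Seq p q) = max (stack_bound p) (stack_bound q)"
| "stack_bound (Branch i p q r) = max (Suc i) (max (stack_bound p) (max (stack_bound q) (stack_bound r)))"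
| "stack_bound (While i p) = max (Suc i) (stack_bound p)"

definition overlay :: "nat \<Rightarrow> store \<Rightarrow> store \<Rightarrow> store" where
  "overlay N s s' = (\<lambda>i. if i < N then s i else s' i)"

lemma overlay_upd: "i < N \<Longrightarrow> overlay N (s(i := x)) s' = (overlay N s s')(i := x)"
  by (auto simp: overlay_def)

lemma overlay_less: "i < N \<Longrightarrow> overlay N s s' i = s i"
  by (simp add: overlay_def)

definition confined :: "nat \<Rightarrow> prog list \<Rightarrow> bool" where
  "confined N ps \<longleftrightarrow> (\<forall>p \<in> set ps. deterministic p \<and> stack_bound p \<le> N)"

text \<open>A deterministic program neither flips nor queries, and one with
  \<open>stack_bound\<close> at most \<open>N\<close> does not look above stack \<open>N\<close>.
  Hence its step is the same under another oracle, before further code and over foreign data on the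
  higher stacks.\<close>

lemma step_frame:
  assumes "confined N ps" "ps \<noteq> []"
  shows "\<exists>qs s'. step f (ps, s) = return_pmf (qs, s') \<and> confined N qs \<and>
    (\<forall>i. length (s' i) \<le> Suc (length (s i))) \<and>
    (\<forall>f' rest s2. step f' (ps @ rest, overlay N s s2) = return_pmf (qs @ rest, overlay N s' s2))"
proof -
  obtain p ps' where ps: "ps = p # ps'" using assms(2) by (cases ps) auto
  have c: "confined N ps'" "deterministic p" "stack_bound p \<le> N"
    using assms(1) by (auto simp: ps confined_def)
  show ?thesis
  proof (cases p)
    case Skip
    show ?thesis using c unfolding ps Skip
      by (intro exI[of _ ps'] exI[of _ s]) auto
  next
    case (Push i b)
    show ?thesis using c unfolding ps Push
      by (intro exI[of _ ps'] exI[of _ "s(i := b # s i)"]) (auto simp: overlay_upd overlay_less)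
  next
    case (Pop i)
    show ?thesis using c unfolding ps Pop
      by (intro exI[of _ ps'] exI[of _ "s(i := tl (s i))"]) (auto simp: overlay_upd overlay_less)
  next
    case (Seq q r)
    show ?thesis using c unfolding ps Seq
      by (intro exI[of _ "q # r # ps'"] exI[of _ s]) (auto simp: confined_def)
  next
    case (Branch i q r u)
    show ?thesis using c unfolding ps Branch
      by (intro exI[of _ "(case s i of [] \<Rightarrow> u | b # _ \<Rightarrow> if b then q else r) # ps'"] exI[of _ s])
        (auto simp: confined_def overlay_less split: list.split)
  next
    case (While i q)
    show ?thesis using c unfolding ps While
      by (intro exI[of _ "if s i = [] then ps' else q # While i q # ps'"] exI[of _ s])
        (auto simp: confined_def overlay_less)
  qed (use c in auto)
qed

text \<open>The embedded run may take fewer than \<open>t\<close> steps: alone the program idles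
  after halting, whereas followed by \<open>rest\<close> it would go on. Each step pushes at most
  one bit per stack, which bounds the output length.\<close>

lemma iter_frame:
  assumes "confined N ps" "iter f t (ps, s) = return_pmf ([], s')"
  shows "(\<exists>t'\<le>t. \<forall>f' rest s2. iter f' t' (ps @ rest, overlay N s s2) = return_pmf (rest, overlay N s' s2))
    \<and> (\<forall>i. length (s' i) \<le> length (s i) + t)"
  using assms
proof (induction t arbitrary: ps s)
  case 0
  then show ?case by simp
next
  case (Suc t)
  show ?case
  proof (cases "ps = []")
    case True
    then show ?thesis using Suc.prems
      by (intro conjI exI[of _ 0]) auto
  next
    case False
    obtain qs s1 where 1: "step f (ps, s) = return_pmf (qs, s1)" "confined N qs"
      "\<And>i. length (s1 i) \<le> Suc (length (s i))"
      "\<And>f' rest s2. step f' (ps @ rest, overlay N s s2) = return_pmf (qs @ rest, overlay N s1 s2)"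
      using step_frame[OF Suc.prems(1) False, of f s] by (elim exE conjE) (rule that, auto)
    have "iter f t (qs, s1) = return_pmf ([], s')"
      using Suc.prems(2) by (simp add: iter_Suc 1(1) bind_return_pmf)
    from Suc.IH[OF 1(2) this] obtain t' where 2: "t' \<le> t"
      "\<And>f' rest s2. iter f' t' (qs @ rest, overlay N s1 s2) = return_pmf (rest, overlay N s' s2)"
      "\<And>i. length (s' i) \<le> length (s1 i) + t" by auto
    have "length (s' i) \<le> length (s i) + Suc t" for i
      using 1(3)[of i] 2(3)[of i] by simp
    moreover have "iter f' (Suc t') (ps @ rest, overlay N s s2) = return_pmf (rest, overlay N s' s2)"
      for f' rest s2 by (simp add: iter_Suc 1(4) 2(2) bind_return_pmf)
    ultimately show ?thesis using 2(1) by (intro conjI exI[of _ "Suc t'"]) auto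
  qed
qed

lemma ev_subroutine:
  assumes "deterministic P" "stack_bound P \<le> N"
    "run P f x t = return_pmf ([], s')" "\<And>i. i < N \<Longrightarrow> s i = ((\<lambda>_. [])(0 := x)) i"
  shows "ev f' P s (overlay N s' s) t" "length (s' i) \<le> length x + t"
proof -
  have c: "confined N [P]" using assms by (simp add: confined_def)
  have s: "overlay N ((\<lambda>_. [])(0 := x)) s = s"
    using assms(4) by (auto simp: overlay_def)
  note 1 = iter_frame[OF c assms(3)[unfolded run_eq_iter]]
  then show "ev f' P s (overlay N s' s) t"
    unfolding ev_def by (elim conjE exE) (use s in \<open>metis append_Cons append_Nil\<close>)
  from 1 have "length (s' i) \<le> length (((\<lambda>_. [])(0 := x)) i) + t" by blast
  then show "length (s' i) \<le> length x + t" by (auto split: if_splits)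
qed

fun clear_below :: "nat \<Rightarrow> prog" where
  "clear_below 0 = Skip"
| "clear_below (Suc n) = Seq (clear n) (clear_below n)"

lemma ev_clear_below:
  assumes "\<And>i. i < N \<Longrightarrow> length (s i) \<le> B"
  shows "ev f (clear_below N) s (overlay N (\<lambda>_. []) s) (N * (2 * B + 2) + 1)"
  using assms
proof (induction N arbitrary: s)
  case 0
  show ?case by (rule ev_loop_freeI) (auto simp: overlay_def)
next
  case (Suc N)
  let ?s = "s(N := [])"
  have "ev f (clear_below N) ?s (overlay N (\<lambda>_. []) ?s) (N * (2 * B + 2) + 1)"
    by (rule Suc.IH) (use Suc.prems in auto)
  from ev_Seq[OF ev_clear this]
  have "ev f (clear_below (Suc N)) s (overlay N (\<lambda>_. []) ?s) (Suc N * (2 * B + 2) + 1)"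
    unfolding clear_below.simps by (rule ev_mono) (use Suc.prems[of N] in simp)
  moreover have "overlay N (\<lambda>_. []) ?s = overlay (Suc N) (\<lambda>_. []) s"
    by (auto simp: overlay_def)
  ultimately show ?case by simp
qed


section \<open>The distinguisher\<close>

text \<open>
  The two tables are on stack 0 and stack \<open>N + 6\<close>. Writing the outputs as \<open>a / (b + 1)\<close> and
  \<open>c / (d + 1)\<close>, the program decides \<open>a * (d + 1) < b * c + c\<close>. Pouring \<open>a\<close> and \<open>b\<close> to
  \<open>N + 7\<close> and \<open>N + 8\<close> reverses them into the order in which \<open>mul\<close> expects its multiplier; the
  random table is reversed too, which does not change its distribution.
\<close>

definition compare_prog :: "nat \<Rightarrow> prog \<Rightarrow> prog" where
  "compare_prog N P = block [P, pour 0 (N + 7), pour 1 (N + 8), clear_below N, pour (N + 6) 0, P,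
     Push (N + 14) True, add 1 (N + 14) (N + 11) (N + 12) (N + 13),
     mul (N + 7) 1 (N + 9) (N + 11) (N + 12) (N + 13),
     mul (N + 8) 0 (N + 10) (N + 11) (N + 12) (N + 13),
     add (N + 10) 0 (N + 11) (N + 12) (N + 13),
     clear_below N, cmp (N + 9) (N + 10) 0]"

text \<open>The bound of \<open>ev_mul\<close> for a multiplier of at most \<open>m\<close> bits and
  a multiplicand of at most \<open>m + 2\<close>, the two extra bits coming from adding one to a
  denominator; \<open>m * (m + 5)\<close> bounds the product length.\<close>

definition mul_time :: "nat \<Rightarrow> nat" where
  "mul_time m = m * (50 * (m * (m + 5) + m + 5) + 11) + 1"

text \<open>The costs of the thirteen pieces of \<open>compare_prog\<close>, grouped by kind; the
  final 12 counts the \<open>Seq\<close> nodes joining them.\<close>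

definition compare_time :: "nat \<Rightarrow> nat \<Rightarrow> nat" where
  "compare_time N m = 2 * m + 3 * (6 * m + 1) + 2 * (N * (2 * (m + 2) + 2) + 1) + 1 +
     50 * (m + 2) + 2 * mul_time m + 50 * (m * (m + 5) + m + 1) +
     20 * (2 * (m * (m + 5)) + m + 1) + 3 + 12"

lemma out_value_less_iff:
  "out_value s < out_value s' \<longleftrightarrow>
     val (s 0) * (val (s' 1) + 1) < val (s 1) * val (s' 0) + val (s' 0)"
proof -
  have "out_value s < out_value s' \<longleftrightarrow>
     real (val (s 0)) * real (val (s' 1) + 1) < real (val (s' 0)) * real (val (s 1) + 1)"
    unfolding out_value_def by (simp add: frac_less_eq divide_simps)
  also have "\<dots> \<longleftrightarrow> val (s 0) * (val (s' 1) + 1) < val (s' 0) * (val (s 1) + 1)"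
    by (simp only: of_nat_mult[symmetric] of_nat_less_iff)
  finally show ?thesis by (simp add: algebra_simps)
qed

lemma ev_compare:
  assumes P: "deterministic P" "stack_bound P \<le> N" "2 \<le> N"
    and G: "s 0 = G" "\<And>i. 0 < i \<Longrightarrow> i < N \<Longrightarrow> s i = []"
    and Z: "\<And>j. 7 \<le> j \<Longrightarrow> s (N + j) = []"
    and o1: "run P f1 G t1 = return_pmf ([], o1)"
    and o2: "run P f2 (rev (s (N + 6))) t2 = return_pmf ([], o2)"
    and m: "length G + t1 \<le> m" "length (s (N + 6)) + t2 \<le> m"
  shows "\<exists>s'. s' 0 = flag (out_value o1 < out_value o2) \<and>
    ev f (compare_prog N P) s s' (compare_time N m)"
proof -
  have o1len: "length (o1 i) \<le> m" for i
    using ev_subroutine(2)[OF P(1,2) o1, of "(\<lambda>_. [])(0 := G)" i] m by simp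
  have o2len: "length (o2 i) \<le> m" for i
    using ev_subroutine(2)[OF P(1,2) o2, of "(\<lambda>_. [])(0 := rev (s (N + 6)))" i] m by simp
  define s1 where "s1 = overlay N o1 s"
  define s2 where "s2 = s1(0 := [], N + 7 := rev (s1 0) @ s1 (N + 7))"
  define s3 where "s3 = s2(1 := [], N + 8 := rev (s2 1) @ s2 (N + 8))"
  define s4 where "s4 = overlay N (\<lambda>_. []) s3"
  define s5 where "s5 = s4(N + 6 := [], 0 := rev (s4 (N + 6)) @ s4 0)"
  define s6 where "s6 = overlay N o2 s5"
  \<comment> \<open>\<open>[True]\<close> is the number one, which turns the stored denominator
    minus one into the denominator.\<close>
  define s7 where "s7 = s6(N + 14 := [True])"
  note sdefs1 = s1_def s2_def s3_def s4_def s5_def s6_def s7_def overlay_def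
  have e1: "ev f P s s1 m"
    unfolding s1_def using m(1)
    by (intro ev_mono[OF ev_subroutine(1)[OF P(1,2) o1]]) (use G in auto)
  have e2: "ev f (pour 0 (N + 7)) s1 s2 (6 * m + 1)"
    unfolding s2_def by (rule ev_mono[OF ev_pour]) (use o1len[of 0] P(3) in \<open>auto simp: sdefs1\<close>)
  have e3: "ev f (pour 1 (N + 8)) s2 s3 (6 * m + 1)"
    unfolding s3_def by (rule ev_mono[OF ev_pour]) (use o1len[of 1] P(3) in \<open>auto simp: sdefs1\<close>)
  have e4: "ev f (clear_below N) s3 s4 (N * (2 * (m + 2) + 2) + 1)"
    unfolding s4_def by (rule ev_clear_below) (use o1len in \<open>auto simp: sdefs1 le_SucI\<close>)
  have s4: "s4 (N + 6) = s (N + 6)" "s4 0 = []"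
    using P(3) by (simp_all add: sdefs1)
  have e5: "ev f (pour (N + 6) 0) s4 s5 (6 * m + 1)"
    unfolding s5_def by (rule ev_mono[OF ev_pour]) (use m(2) s4 P(3) in auto)
  have s5: "s5 i = ((\<lambda>_. [])(0 := rev (s (N + 6)))) i" if "i < N" for i
    using that s4 P(3) by (simp add: s5_def) (simp add: s4_def overlay_def)
  have e6: "ev f P s5 s6 m"
    unfolding s6_def by (rule ev_mono[OF ev_subroutine(1)[OF P(1,2) o2]]) (use s5 m in auto)
  have e7: "ev f (Push (N + 14) True) s6 s7 1"
    unfolding s7_def by (rule ev_loop_freeI) (use Z[of 14] P(3) in \<open>auto simp: sdefs1\<close>)
  have s7: "s7 0 = o2 0" "s7 1 = o2 1" "s7 (N + 7) = rev (o1 0)" "s7 (N + 8) = rev (o1 1)"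
    "s7 (N + 9) = []" "s7 (N + 10) = []" "s7 (N + 11) = []" "s7 (N + 12) = []" "s7 (N + 13) = []"
    "s7 (N + 14) = [True]"
    using P(3) Z by (simp_all add: sdefs1)
  have "s7 i = o2 i" if "i < N" for i using that by (simp add: s7_def s6_def overlay_def)
  then have s7len: "length (s7 i) \<le> m" if "i < N" for i using that o2len by simp
  have "distinct [1, N + 14, N + 11, N + 12, N + 13]" using P(3) by simp
  from ev_add[OF this s7(9,7,8), of f, unfolded s7(2,10)] obtain z1 where
    z1: "length z1 \<le> length (o2 1) + length [True] + 1" "val z1 = val (o2 1) + val [True]"
    and e8: "ev f (add 1 (N + 14) (N + 11) (N + 12) (N + 13)) s7 (s7(1 := z1))
      (50 * (length (o2 1) + length [True] + 1))"
    by (elim exE conjE) (rule that)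
  define s8 where "s8 = s7(1 := z1)"
  have s8: "s8 0 = o2 0" "s8 1 = z1" "s8 (N + 7) = rev (o1 0)" "s8 (N + 8) = rev (o1 1)"
    "s8 (N + 9) = []" "s8 (N + 10) = []" "s8 (N + 11) = []" "s8 (N + 12) = []" "s8 (N + 13) = []"
    using P(3) s7 by (simp_all add: s8_def)
  have z1len: "length z1 \<le> m + 2" using z1(1) o2len[of 1] by simp
  have s8len: "length (s8 i) \<le> m + 2" if "i < N" for i
    using s7len[OF that] z1len by (simp add: s8_def)
  have "distinct [N + 7, 1, N + 9, N + 11, N + 12, N + 13]" using P(3) by simp
  moreover have "length (s8 (N + 9)) + length (s8 (N + 7)) * (length (s8 1) + 2) \<le> m * (m + 5)"
    unfolding s8 list.size length_rev add_0 by (rule mult_le_mono) (use o1len[of 0] z1len in auto)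
  ultimately obtain z2 where z2: "length z2 \<le> m * (m + 5)"
    "val z2 = val (o1 0) * val z1"
    and e9: "ev f (mul (N + 7) 1 (N + 9) (N + 11) (N + 12) (N + 13)) s8 (s8(N + 7 := [], N + 9 := z2))
      (length (o1 0) * (50 * (m * (m + 5) + length z1 + 2) + 11) + 1)"
    using ev_mul[of "N + 7" 1 "N + 9" "N + 11" "N + 12" "N + 13" s8 "m * (m + 5)" f]
    unfolding s8 rev_rev_ident length_rev by (auto simp del: fun_upd_apply)
  define s9 where "s9 = s8(N + 7 := [], N + 9 := z2)"
  have s9: "s9 0 = o2 0" "s9 (N + 8) = rev (o1 1)"
    "s9 (N + 9) = z2" "s9 (N + 10) = []" "s9 (N + 11) = []" "s9 (N + 12) = []" "s9 (N + 13) = []"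
    using P(3) s8 by (simp_all add: s9_def)
  have s9len: "length (s9 i) \<le> m + 2" if "i < N" for i
    using s8len[OF that] that by (simp add: s9_def)
  have "distinct [N + 8, 0, N + 10, N + 11, N + 12, N + 13]" using P(3) by simp
  moreover have "length (s9 (N + 10)) + length (s9 (N + 8)) * (length (s9 0) + 2) \<le> m * (m + 5)"
    unfolding s9 list.size length_rev add_0 by (rule mult_le_mono) (use o1len[of 1] o2len[of 0] in auto)
  ultimately obtain z3 where z3: "length z3 \<le> m * (m + 5)"
    "val z3 = val (o1 1) * val (o2 0)"
    and e10: "ev f (mul (N + 8) 0 (N + 10) (N + 11) (N + 12) (N + 13)) s9 (s9(N + 8 := [], N + 10 := z3))
      (length (o1 1) * (50 * (m * (m + 5) + length (o2 0) + 2) + 11) + 1)"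
    using ev_mul[of "N + 8" 0 "N + 10" "N + 11" "N + 12" "N + 13" s9 "m * (m + 5)" f]
    unfolding s9 rev_rev_ident length_rev by (auto simp del: fun_upd_apply)
  define s10 where "s10 = s9(N + 8 := [], N + 10 := z3)"
  have s10: "s10 0 = o2 0" "s10 (N + 9) = z2" "s10 (N + 10) = z3"
    "s10 (N + 11) = []" "s10 (N + 12) = []" "s10 (N + 13) = []"
    using P(3) s9 by (simp_all add: s10_def)
  have s10len: "length (s10 i) \<le> m + 2" if "i < N" for i
    using s9len[OF that] that by (simp add: s10_def)
  have "distinct [N + 10, 0, N + 11, N + 12, N + 13]" using P(3) by simp
  from ev_add[OF this s10(6,4,5), of f, unfolded s10(1,3)] obtain z4 where
    z4: "length z4 \<le> length z3 + length (o2 0) + 1" "val z4 = val z3 + val (o2 0)"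
    and e11: "ev f (add (N + 10) 0 (N + 11) (N + 12) (N + 13)) s10 (s10(N + 10 := z4))
      (50 * (length z3 + length (o2 0) + 1))"
    by (elim exE conjE) (rule that)
  define s11 where "s11 = s10(N + 10 := z4)"
  \<comment> \<open>Stack 0 must be empty to receive the verdict of \<open>cmp\<close>; the two
    sides of the comparison lie above \<open>N\<close> and survive.\<close>
  define s12 where "s12 = overlay N (\<lambda>_. []) s11"
  have e12: "ev f (clear_below N) s11 s12 (N * (2 * (m + 2) + 2) + 1)"
    unfolding s12_def by (rule ev_clear_below) (use s10len in \<open>auto simp: s11_def\<close>)
  have s12: "s12 0 = []" "s12 (N + 9) = z2" "s12 (N + 10) = z4"
    using P(3) s10 by (simp_all add: s12_def s11_def overlay_def)
  have "distinct [N + 9, N + 10, 0]" using P(3) by simp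
  note e13 = ev_cmp[where s = s12 and f = f, OF this s12(1), unfolded s12]
  define s13 where "s13 = s12(N + 9 := [], N + 10 := [], 0 := flag (val z2 < val z4))"
  \<comment> \<open>With outputs \<open>a / (b + 1)\<close> and \<open>c / (d + 1)\<close>, the
    values of \<open>z1\<close>, \<open>z2\<close>, \<open>z3\<close>, \<open>z4\<close> are
    \<open>d + 1\<close>, \<open>a * (d + 1)\<close>, \<open>b * c\<close> and
    \<open>b * c + c\<close>.\<close>
  have v: "val z2 < val z4 \<longleftrightarrow> out_value o1 < out_value o2"
    unfolding z2 z4 z3 z1 out_value_less_iff by simp
  have t9: "length (o1 0) * (50 * (m * (m + 5) + length z1 + 2) + 11) + 1 \<le> mul_time m"
    unfolding mul_time_def
    by (rule add_le_mono1, rule mult_le_mono) (use o1len[of 0] z1len in auto)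
  have t10: "length (o1 1) * (50 * (m * (m + 5) + length (o2 0) + 2) + 11) + 1 \<le> mul_time m"
    unfolding mul_time_def
    by (rule add_le_mono1, rule mult_le_mono) (use o1len[of 1] o2len[of 0] in auto)
  have "ev f (compare_prog N P) s s13 (compare_time N m)"
    unfolding compare_prog_def block.simps
    apply (rule ev_mono)
     apply (rule ev_Seq[OF e1 ev_Seq[OF e2 ev_Seq[OF e3 ev_Seq[OF e4 ev_Seq[OF e5 ev_Seq[OF e6 ev_Seq[OF e7
        ev_Seq[OF e8[folded s8_def] ev_Seq[OF e9[folded s9_def] ev_Seq[OF e10[folded s10_def]
        ev_Seq[OF e11[folded s11_def] ev_Seq[OF e12 e13[folded s13_def]]]]]]]]]]]]])
    using t9 t10 z2(1) z3(1) z4(1) o2len[of 1] o2len[of 0] by (simp add: compare_time_def)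
  moreover have "s13 0 = flag (out_value o1 < out_value o2)"
    using v by (simp add: s13_def)
  ultimately show ?thesis by blast
qed


lemma iter_ev:
  assumes "ev f p s s' T" "T \<le> t"
  shows "iter f t ([p], s) = return_pmf ([], s')"
proof -
  obtain t' where t': "t' \<le> T" "iter f t' ([p], s) = return_pmf ([], s')"
    using assms(1) unfolding ev_def by blast
  then have "iter f (t' + (t - t')) ([p], s) = return_pmf ([], s')"
    unfolding iter_add t'(2) by (simp add: bind_return_pmf)
  then show ?thesis using t'(1) assms(2) by simp
qed

definition sample_prog :: "nat \<Rightarrow> nat \<Rightarrow> prog" where
  "sample_prog N K = block [init_prog 0 N (N + 1), Push (N + 2) True,
     scale_prog K (N + 1) (N + 2) (N + 3), table_prog (N + 2) N 0 (N + 5) (N + 3) (N + 4)]"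

definition sample_time :: "nat \<Rightarrow> nat \<Rightarrow> nat \<Rightarrow> nat" where
  "sample_time K m w = 6 * m + 1 + 1 + (m * (20 * m + K * (20 * w + 11) + 30) + 1) +
     (w * (20 * m + 40) + 1) + 3"

text \<open>Only the length of the input enters. For small \<open>m\<close>, where
  \<open>K * bitlen m\<close> exceeds \<open>m\<close>, the countdown wraps around; the running time
  is bounded there too, as \<open>time_bound\<close> demands.\<close>

definition queries :: "nat \<Rightarrow> nat \<Rightarrow> bool list list" where
  "queries K m = countdown (2 ^ (K * bitlen m)) (replicate m True)"

lemma ev_sample:
  assumes "2 \<le> N" "2 ^ (K * bitlen (length x)) \<le> w"
  shows "\<exists>s. ev f (sample_prog N K) ((\<lambda>_. [])(0 := x)) s (sample_time K (length x) w) \<and>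
    s 0 = rev (map f (queries K (length x))) \<and>
    s (N + 5) = replicate (2 ^ (K * bitlen (length x))) True \<and>
    (\<forall>i. i \<noteq> 0 \<and> i \<noteq> N \<and> i \<noteq> N + 5 \<longrightarrow> s i = [])"
proof -
  define m where "m = length x"
  define n where "n = (2::nat) ^ (K * bitlen m)"
  define s0 :: store where "s0 = (\<lambda>_. [])(0 := x)"
  define s1 where "s1 = s0(0 := [], N := replicate (length (s0 0)) True, N + 1 := replicate (length (s0 0)) True)"
  define s2 where "s2 = s1(N + 2 := [True])"
  define s3 where "s3 = s2(N + 1 := [], N + 2 := replicate n True)"
  define s4 where "s4 = s3(N + 2 := [], N := (decr ^^ n) (s3 N),
    0 := rev (map f (countdown n (s3 N))) @ s3 0, N + 5 := replicate n True @ s3 (N + 5))"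
  note sdefs = s0_def s1_def s2_def s3_def
  have e1: "ev f (init_prog 0 N (N + 1)) s0 s1 (6 * m + 1)"
    unfolding s1_def by (rule ev_mono[OF ev_init]) (use assms in \<open>auto simp: s0_def m_def\<close>)
  have e2: "ev f (Push (N + 2) True) s1 s2 1"
    by (rule ev_loop_freeI) (auto simp: s0_def s1_def s2_def)
  have d: "distinct [N + 1, N + 2, N + 3]" by simp
  have s2: "s2 (N + 1) = replicate m True" "s2 (N + 2) = replicate 1 True" "s2 (N + 3) = []"
    using assms by (simp_all add: s0_def s1_def s2_def m_def)
  have nw: "1 * 2 ^ (K * bitlen m) \<le> w" using assms(2) by (simp add: m_def)
  have e3: "ev f (scale_prog K (N + 1) (N + 2) (N + 3)) s2 s3
     (m * (20 * m + K * (20 * w + 11) + 30) + 1)"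
    using ev_scale[OF d s2 nw order_refl, of f] unfolding s3_def n_def by (simp only: mult_1)
  have d: "distinct [N + 2, N, 0, N + 5, N + 3, N + 4]" using assms by simp
  have s3: "s3 (N + 4) = []" "s3 (N + 3) = []" "s3 (N + 2) = replicate n True"
    "s3 N = replicate m True" "s3 0 = []"
    using assms by (simp_all add: sdefs m_def)
  have "ev f (table_prog (N + 2) N 0 (N + 5) (N + 3) (N + 4)) s3 s4
     (n * (20 * length (s3 N) + 40) + 1)"
    unfolding s4_def by (rule ev_table[OF d s3(1-3)])
  then have e4: "ev f (table_prog (N + 2) N 0 (N + 5) (N + 3) (N + 4)) s3 s4
     (w * (20 * m + 40) + 1)"
    by (rule ev_mono) (use nw in \<open>simp add: s3 n_def mult_le_mono1\<close>)
  have "ev f (sample_prog N K) s0 s4 (sample_time K m w)"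
    unfolding sample_prog_def block.simps
    by (rule ev_mono[OF ev_Seq[OF e1 ev_Seq[OF e2 ev_Seq[OF e3 e4]]]]) (simp add: sample_time_def)
  moreover have "s4 0 = rev (map f (queries K m))"
    using assms by (simp add: s4_def s3 queries_def n_def)
  moreover have "s4 (N + 5) = replicate n True"
    by (simp add: s4_def) (simp add: sdefs)
  moreover have "s4 i = []" if "i \<noteq> 0" "i \<noteq> N" "i \<noteq> N + 5" for i
    using that by (simp add: s4_def) (simp add: sdefs)
  ultimately show ?thesis unfolding s0_def m_def n_def by blast
qed

lemma length_queries [simp]: "length (queries K m) = 2 ^ (K * bitlen m)"
  by (simp add: queries_def countdown_def)

definition dist_prog :: "nat \<Rightarrow> nat \<Rightarrow> prog \<Rightarrow> prog" where
  "dist_prog N K P = Seq (sample_prog N K) (Seq (flip_prog (N + 5) (N + 6)) (compare_prog N P))"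

text \<open>\<open>w\<close> is any bound on the table length; it becomes
  \<open>(2 * m + 1) ^ K\<close>, which makes the whole expression polynomial in
  \<open>m\<close>.\<close>

definition dist_time :: "nat \<Rightarrow> nat \<Rightarrow> nat poly \<Rightarrow> nat \<Rightarrow> nat \<Rightarrow> nat" where
  "dist_time N K p m w = sample_time K m w + (4 * w + 1) + compare_time N (w + poly p w) + 2"

lemma poly_nat_mono: "x \<le> y \<Longrightarrow> poly p x \<le> poly p (y :: nat)"
  by (induction p) (auto intro!: add_mono mult_le_mono)

text \<open>Acceptance depends only on the remaining code and stack 0, so the other stacks are
  projected away. The coins are the only randomness; the phases before and after them are
  deterministic.\<close>

lemma run_dist:
  assumes P: "deterministic P" "stack_bound P \<le> N" "2 \<le> N"
    and A: "\<And>x. run P (\<lambda>_. False) x (poly p (length x)) = return_pmf ([], out x)"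
    and w: "2 ^ (K * bitlen (length x)) \<le> w" and t: "dist_time N K p (length x) w \<le> t"
  shows "map_pmf (\<lambda>(ps, s). (ps, s 0)) (run (dist_prog N K P) f x t) =
    map_pmf (\<lambda>H. ([], flag (out_value (out (rev (map f (queries K (length x))))) < out_value (out (rev H)))))
      (pmf_of_set (bitstrings (2 ^ (K * bitlen (length x)))))"
proof -
  define n where "n = (2::nat) ^ (K * bitlen (length x))"
  define s0 :: store where "s0 = (\<lambda>_. [])(0 := x)"
  define G where "G = rev (map f (queries K (length x)))"
  define flip where "flip = flip_prog (N + 5) (N + 6)"
  obtain s where s: "ev f (sample_prog N K) s0 s (sample_time K (length x) w)"
    "s 0 = G" "s (N + 5) = replicate n True" "\<And>i. i \<noteq> 0 \<Longrightarrow> i \<noteq> N \<Longrightarrow> i \<noteq> N + 5 \<Longrightarrow> s i = []"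
    using ev_sample[OF P(3) w, of f] unfolding s0_def G_def n_def by blast
  obtain t1 where t1: "t1 \<le> sample_time K (length x) w"
    "\<And>ps. iter f t1 (sample_prog N K # ps, s0) = return_pmf (ps, s)"
    using s(1) unfolding ev_def by blast
  define sH where "sH H = s(N + 5 := [], N + 6 := H @ s (N + 6))" for H
  define T where "T = compare_time N (w + poly p w)"
  have "\<exists>s'. s' 0 = flag (out_value (out G) < out_value (out (rev H))) \<and>
    ev f (compare_prog N P) (sH H) s' T" if H: "H \<in> bitstrings n" for H
  proof -
    have 1: "sH H 0 = G" "\<And>i. 0 < i \<Longrightarrow> i < N \<Longrightarrow> sH H i = []"
      "\<And>j. 7 \<le> j \<Longrightarrow> sH H (N + j) = []" "sH H (N + 6) = H"
      using s P(3) by (simp_all add: sH_def)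
    have len: "length G \<le> w" "length H \<le> w"
      using w H by (simp_all add: G_def n_def bitstrings_def)
    show ?thesis unfolding T_def
    proof (rule ev_compare[OF P 1(1-3) A])
      show "run P (\<lambda>_. False) (rev (sH H (N + 6))) (poly p (length H)) = return_pmf ([], out (rev H))"
        using A[of "rev H"] 1(4) by simp
    qed (use len 1(4) in \<open>auto intro!: add_mono poly_nat_mono\<close>)
  qed
  then obtain S where S: "\<And>H. H \<in> bitstrings n \<Longrightarrow> S H 0 = flag (out_value (out G) < out_value (out (rev H)))"
    "\<And>H. H \<in> bitstrings n \<Longrightarrow> ev f (compare_prog N P) (sH H) (S H) T"
    by metis
  \<comment> \<open>The 2 counts the unfoldings of the two outer \<open>Seq\<close>. All remaining
    steps go to the comparison, which idles once it has halted.\<close>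
  define r where "r = t - (t1 + (4 * n + 1) + 2)"
  have r: "t = Suc t1 + (Suc (4 * n + 1) + r)" "T \<le> r"
    using t t1(1) w unfolding r_def dist_time_def T_def n_def by linarith+
  have "run (dist_prog N K P) f x t = bind_pmf (iter f (Suc (4 * n + 1)) ([Seq flip (compare_prog N P)], s)) (iter f r)"
    unfolding run_eq_iter r(1) iter_add
    by (simp add: iter_Suc bind_return_pmf dist_prog_def t1(2) s0_def[symmetric] flip_def)
  also have "iter f (Suc (4 * n + 1)) ([Seq flip (compare_prog N P)], s) =
      iter f (4 * n + 1) (flip # [compare_prog N P], s)"
    by (subst iter_Suc) (simp add: bind_return_pmf)
  also have "\<dots> = map_pmf (\<lambda>H. ([compare_prog N P], sH H)) (pmf_of_set (bitstrings n))"
    using iter_flip[of "N + 5" "N + 6" f s "[compare_prog N P]"] s(3) by (simp add: sH_def flip_def)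
  also have "bind_pmf \<dots> (iter f r) = map_pmf (\<lambda>H. ([], S H)) (pmf_of_set (bitstrings n))"
  proof -
    have "iter f r ([compare_prog N P], sH H) = return_pmf ([], S H)" if "H \<in> bitstrings n" for H
      by (rule iter_ev[OF S(2)[OF that] r(2)])
    then show ?thesis
      unfolding bind_map_pmf unfolding map_pmf_def by (intro bind_pmf_cong refl) auto
  qed
  finally have "map_pmf (\<lambda>(ps, s). (ps, s 0)) (run (dist_prog N K P) f x t) =
      map_pmf (\<lambda>H. ([], S H 0)) (pmf_of_set (bitstrings n))"
    by (simp add: pmf.map_comp comp_def)
  also have "\<dots> = map_pmf (\<lambda>H. ([], flag (out_value (out G) < out_value (out (rev H))))) (pmf_of_set (bitstrings n))"
    by (intro map_pmf_cong refl) (use S(1) in auto)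
  finally show ?thesis unfolding G_def n_def .
qed


section \<open>Acceptance probabilities\<close>

text \<open>Coins are drawn independently of the oracle, so acceptance becomes an event under a
  product distribution, free of machines.\<close>

lemma accept_prob_eq:
  assumes "\<And>f. f \<in> F \<Longrightarrow> map_pmf (\<lambda>(ps, s). (ps, s 0)) (run M f (replicate n True) t) =
      map_pmf (\<lambda>H. ([], flag (Q f H))) R"
    and F: "finite F" "F \<noteq> {}"
  shows "accept_prob M F n t = measure_pmf.prob (pair_pmf (pmf_of_set F) R) {(f, H). Q f H}"
proof -
  let ?D = "bind_pmf (pmf_of_set F) (\<lambda>f. run M f (replicate n True) t)"
  have "accept_prob M F n t = measure_pmf.prob (map_pmf (\<lambda>(ps, s). (ps, s 0)) ?D) {([], [True])}"
    unfolding accept_prob_def measure_map_pmf by (intro arg_cong[where f = "measure _"]) auto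
  also have "map_pmf (\<lambda>(ps, s). (ps, s 0)) ?D =
      bind_pmf (pmf_of_set F) (\<lambda>f. map_pmf (\<lambda>H. ([], flag (Q f H))) R)"
    unfolding map_bind_pmf by (intro bind_pmf_cong refl) (use assms in auto)
  also have "\<dots> = map_pmf (\<lambda>(f, H). ([], flag (Q f H))) (pair_pmf (pmf_of_set F) R)"
    by (simp add: pair_pmf_def map_bind_pmf map_pmf_def bind_assoc_pmf bind_return_pmf)
  also have "measure_pmf.prob \<dots> {([], [True])} = measure_pmf.prob (pair_pmf (pmf_of_set F) R) {(f, H). Q f H}"
    unfolding measure_map_pmf by (intro arg_cong[where f = "measure _"]) (auto simp: flag_def split: if_splits)
  finally show ?thesis .
qed

text \<open>Swapping the components preserves the distribution and exchanges two disjoint events, so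
  neither exceeds 1/2. Ties only lower the probability.\<close>

lemma pair_pmf_symmetric_le_half:
  fixes A :: "'a \<Rightarrow> real"
  shows "measure_pmf.prob (pair_pmf U U) {(g, h). A g < A h} \<le> 1 / 2"
proof -
  let ?p = "measure_pmf.prob (pair_pmf U U)"
  have "?p {(g, h). A g < A h} = measure_pmf.prob (map_pmf (\<lambda>(x, y). (y, x)) (pair_pmf U U)) {(g, h). A g < A h}"
    by (simp flip: pair_commute_pmf)
  also have "\<dots> = ?p {(g, h). A h < A g}"
    unfolding measure_map_pmf by (intro arg_cong[where f = "measure _"]) auto
  finally have "2 * ?p {(g, h). A g < A h} = ?p {(g, h). A g < A h} + ?p {(g, h). A h < A g}"
    by simp
  also have "\<dots> = ?p ({(g, h). A g < A h} \<union> {(g, h). A h < A g})"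
    by (subst measure_pmf.finite_measure_Union) auto
  also have "\<dots> \<le> 1" by simp
  finally show ?thesis by simp
qed

lemma boolfuns_eq_PiE_dflt: "boolfuns n = PiE_dflt (bitstrings n) False (\<lambda>_. UNIV)"
  by (auto simp: boolfuns_def PiE_dflt_def bitstrings_def)

lemma finite_boolfuns [simp]: "finite (boolfuns n)"
  unfolding boolfuns_eq_PiE_dflt by (intro finite_PiE_dflt) auto

lemma boolfuns_nonempty [simp]: "boolfuns n \<noteq> {}"
  by (auto simp: boolfuns_def)

text \<open>A uniform function is a product of independent fair bits. Its marginal on
  \<open>set xs\<close> is again such a product, and listing the values is a bijection onto the
  strings of that length.\<close>

lemma map_boolfuns_uniform:
  assumes "distinct xs" "set xs \<subseteq> bitstrings n"
  shows "map_pmf (\<lambda>f. map f xs) (pmf_of_set (boolfuns n)) = pmf_of_set (bitstrings (length xs))"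
proof -
  let ?U = "pmf_of_set (UNIV :: bool set)"
  let ?B = "PiE_dflt (set xs) False (\<lambda>_. UNIV :: bool set)"
  have "pmf_of_set (boolfuns n) = Pi_pmf (bitstrings n) False (\<lambda>_. ?U)"
    unfolding boolfuns_eq_PiE_dflt by (rule Pi_pmf_of_set[symmetric]) auto
  then have "map_pmf (\<lambda>f x. if x \<in> set xs then f x else False) (pmf_of_set (boolfuns n)) =
      Pi_pmf (set xs) False (\<lambda>_. ?U)"
    using Pi_pmf_subset[of "bitstrings n" "set xs" False "\<lambda>_. ?U"] assms(2) by simp
  also have "\<dots> = pmf_of_set ?B"
    by (rule Pi_pmf_of_set) auto
  finally have 1: "map_pmf (\<lambda>f x. if x \<in> set xs then f x else False) (pmf_of_set (boolfuns n)) = pmf_of_set ?B" .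
  have "map_pmf (\<lambda>f. map f xs) (pmf_of_set (boolfuns n)) =
      map_pmf (\<lambda>f. map f xs) (map_pmf (\<lambda>f x. if x \<in> set xs then f x else False) (pmf_of_set (boolfuns n)))"
    unfolding pmf.map_comp by (intro map_pmf_cong refl) auto
  also have "\<dots> = map_pmf (\<lambda>f. map f xs) (pmf_of_set ?B)"
    unfolding 1 ..
  also have "\<dots> = pmf_of_set ((\<lambda>f. map f xs) ` ?B)"
  proof (rule map_pmf_of_set_inj)
    show "inj_on (\<lambda>f. map f xs) ?B"
    proof (rule inj_onI)
      fix f g assume fg: "f \<in> ?B" "g \<in> ?B" "map f xs = map g xs"
      show "f = g"
      proof
        fix x show "f x = g x" using fg by (cases "x \<in> set xs") (auto simp: PiE_dflt_def)
      qed
    qed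
    show "?B \<noteq> {}" by (auto simp: PiE_dflt_def)
    show "finite ?B" by (intro finite_PiE_dflt) auto
  qed
  also have "(\<lambda>f. map f xs) ` ?B = bitstrings (length xs)"
  proof (intro set_eqI iffI)
    fix ys :: "bool list" assume ys: "ys \<in> bitstrings (length xs)"
    define f where "f x = (case map_of (zip xs ys) x of None \<Rightarrow> False | Some b \<Rightarrow> b)" for x
    have "f \<in> ?B" using ys by (auto simp: PiE_dflt_def f_def bitstrings_def split: option.split dest: map_of_SomeD set_zip_leftD)
    moreover have "map f xs = ys"
      using ys assms(1) by (intro nth_equalityI) (auto simp: f_def bitstrings_def map_of_zip_nth)
    ultimately show "ys \<in> (\<lambda>f. map f xs) ` ?B" by blast
  qed (auto simp: bitstrings_def)
  finally show ?thesis .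
qed


section \<open>Restrictions\<close>

text \<open>The last \<open>j\<close> variables are set to \<open>True\<close> because the countdown
  starts at the all-ones string and changes only its front.\<close>

definition restr :: "nat \<Rightarrow> boolfun \<Rightarrow> boolfun" where
  "restr j f = (\<lambda>x. f (x @ replicate j True))"

lemma restr_in_boolfuns: "f \<in> boolfuns (k + j) \<Longrightarrow> restr j f \<in> boolfuns k"
  by (auto simp: restr_def boolfuns_def)

lemma set_n_lists_bool: "set (List.n_lists k [False, True]) = bitstrings k"
  by (auto simp: set_n_lists bitstrings_def)

lemma distinct_n_lists_bool: "distinct (List.n_lists k [False, True])"
  by (rule distinct_n_lists) simp

lemma length_n_lists_bool: "length (List.n_lists k [False, True]) = 2 ^ k"
  by (simp add: length_n_lists numeral_2_eq_2)

lemma truth_table_in_bitstrings: "truth_table k f \<in> bitstrings (2 ^ k)"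
  by (simp add: truth_table_def bitstrings_def length_n_lists_bool)

lemma truth_table_inj: "inj_on (truth_table k) (boolfuns k)"
proof (rule inj_onI)
  fix f g assume fg: "f \<in> boolfuns k" "g \<in> boolfuns k" "truth_table k f = truth_table k g"
  show "f = g"
  proof
    fix x show "f x = g x"
    proof (cases "length x = k")
      case True
      then have "x \<in> set (List.n_lists k [False, True])"
        by (simp add: set_n_lists_bool bitstrings_def)
      then show ?thesis using fg(3) by (simp add: truth_table_def)
    qed (use fg in \<open>auto simp: boolfuns_def\<close>)
  qed
qed

lemma truth_table_restr_uniform:
  "map_pmf (\<lambda>f. truth_table k (restr j f)) (pmf_of_set (boolfuns (k + j))) = pmf_of_set (bitstrings (2 ^ k))"
proof -
  let ?xs = "map (\<lambda>x. x @ replicate j True) (List.n_lists k [False, True])"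
  have d: "distinct ?xs" by (simp add: distinct_map distinct_n_lists_bool inj_on_def)
  have s: "set ?xs \<subseteq> bitstrings (k + j)" using set_n_lists_bool[of k] by (auto simp: bitstrings_def)
  have "(\<lambda>f. truth_table k (restr j f)) = (\<lambda>f. map f ?xs)"
    by (auto simp: truth_table_def restr_def)
  then show ?thesis
    using map_boolfuns_uniform[OF d s] by (simp add: length_n_lists_bool)
qed

lemma truth_table_uniform:
  "map_pmf (truth_table k) (pmf_of_set (boolfuns k)) = pmf_of_set (bitstrings (2 ^ k))"
  using truth_table_restr_uniform[of k 0] by (simp add: restr_def)

context model_class
begin

lemma complexity_witness:
  assumes "f \<in> boolfuns n"
  obtains M where "computes M n f" "msize M = complexity computes msize n f"
proof -
  have "\<exists>s. \<exists>M. computes M n f \<and> msize M = s" using complete[OF assms] by blast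
  from LeastI_ex[OF this] that show ?thesis unfolding complexity_def by blast
qed

lemma complexity_le: "computes M n f \<Longrightarrow> complexity computes msize n f \<le> msize M"
  unfolding complexity_def by (intro Least_le) blast

text \<open>For strings up to length \<open>k\<close> both insertions agree. For longer ones both
  arguments have a length at which \<open>f\<close> is \<open>False\<close>.\<close>

lemma fix_last_True:
  assumes "f \<in> boolfuns (Suc k)"
  shows "fix_var k True f = (\<lambda>x. f (x @ [True]))"
proof
  fix x :: "bool list"
  show "fix_var k True f x = f (x @ [True])"
  proof (cases "length x \<le> k")
    case False
    then have "\<not> f (take k x @ True # drop k x)" "\<not> f (x @ [True])"
      using assms by (force simp: boolfuns_def)+
    then show ?thesis by (simp add: fix_var_def)
  qed (simp add: fix_var_def)
qed

lemma complexity_restr: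
  assumes "f \<in> boolfuns (k + j)"
  shows "complexity computes msize k (restr j f) \<le> complexity computes msize (k + j) f"
  using assms
proof (induction j arbitrary: f)
  case 0
  then show ?case by (simp add: restr_def)
next
  case (Suc j)
  obtain M where M: "computes M (Suc (k + j)) f" "msize M = complexity computes msize (Suc (k + j)) f"
    using complexity_witness Suc.prems by auto
  define g where "g = (\<lambda>x. f (x @ [True]))"
  have f: "f \<in> boolfuns (Suc (k + j))" using Suc.prems by simp
  from restriction[OF f M(1) order_refl, of True] obtain M' where
    "computes M' (k + j) g" "msize M' \<le> msize M"
    unfolding fix_last_True[OF f] g_def by blast
  then have "complexity computes msize (k + j) g \<le> complexity computes msize (k + Suc j) f"
    using complexity_le M(2) by fastforce
  moreover have "g \<in> boolfuns (k + j)" using f by (auto simp: g_def boolfuns_def)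
  moreover have "restr j g = restr (Suc j) f"
    by (simp add: restr_def g_def replicate_append_same)
  ultimately show ?case using Suc.IH[of g] by simp
qed

end


section \<open>Polynomial bounds\<close>

text \<open>An upper bound suffices for the running time, and it has closure rules that handle
  \<open>dist_time\<close> without computing a polynomial.\<close>

definition poly_bounded :: "(nat \<Rightarrow> nat) \<Rightarrow> bool" where
  "poly_bounded g \<longleftrightarrow> (\<exists>p. \<forall>n. g n \<le> poly p n)"

lemma poly_bounded_const: "poly_bounded (\<lambda>n. c)"
  unfolding poly_bounded_def by (intro exI[of _ "[:c:]"]) simp

lemma poly_bounded_id: "poly_bounded (\<lambda>n. n)"
  unfolding poly_bounded_def by (intro exI[of _ "[:0, 1:]"]) simp

lemma poly_bounded_add:
  "poly_bounded g \<Longrightarrow> poly_bounded h \<Longrightarrow> poly_bounded (\<lambda>n. g n + h n)"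
  unfolding poly_bounded_def by (elim exE, rule_tac x = "p + pa" in exI) (simp add: add_mono)

lemma poly_bounded_mult:
  "poly_bounded g \<Longrightarrow> poly_bounded h \<Longrightarrow> poly_bounded (\<lambda>n. g n * h n)"
  unfolding poly_bounded_def by (elim exE, rule_tac x = "p * pa" in exI) (simp add: mult_le_mono)

lemma poly_bounded_power: "poly_bounded g \<Longrightarrow> poly_bounded (\<lambda>n. g n ^ k)"
  by (induction k) (auto intro: poly_bounded_const poly_bounded_mult)

lemma poly_bounded_poly: "poly_bounded g \<Longrightarrow> poly_bounded (\<lambda>n. poly p (g n))"
  unfolding poly_bounded_def
  by (elim exE, rule_tac x = "pcompose p pa" in exI) (auto simp: poly_pcompose intro: poly_nat_mono)

lemmas poly_bounded_intros = poly_bounded_const poly_bounded_id poly_bounded_add poly_bounded_mult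
  poly_bounded_power poly_bounded_poly

lemma power_bitlen_le_poly: "2 ^ (K * bitlen m) \<le> (2 * m + 1) ^ K"
proof (cases "m = 0")
  case False
  then have "2 ^ bitlen m \<le> 2 * m + 1" using power_bitlen_le[of m] by simp
  then have "(2 ^ bitlen m) ^ K \<le> (2 * m + 1) ^ K" by (rule power_mono) simp
  then show ?thesis by (simp add: power_mult[symmetric] mult.commute)
qed simp

lemma poly_bounded_dist_time: "poly_bounded (\<lambda>m. dist_time N K p m ((2 * m + 1) ^ K))"
  unfolding dist_time_def sample_time_def compare_time_def mul_time_def
  by (intro poly_bounded_intros)

lemma run_dist_halts:
  assumes P: "deterministic P" "stack_bound P \<le> N" "2 \<le> N"
    and A: "\<And>x. run P (\<lambda>_. False) x (poly p (length x)) = return_pmf ([], out x)"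
    and t: "dist_time N K p (length x) ((2 * length x + 1) ^ K) \<le> t"
    and c: "c \<in> set_pmf (run (dist_prog N K P) f x t)"
  shows "fst c = []"
proof -
  have "(fst c, snd c 0) \<in> set_pmf (map_pmf (\<lambda>(ps, s). (ps, s 0)) (run (dist_prog N K P) f x t))"
    using c by (force simp: set_map_pmf)
  then show ?thesis
    unfolding run_dist[OF P A power_bitlen_le_poly t] by auto
qed

text \<open>Two reversals cancel: the countdown runs against the order of the truth table, and
  stacking the answers reverses them again. The assumption keeps the varying bits inside the query
  string.\<close>

lemma queries_eq:
  assumes "K * bitlen m \<le> m"
  shows "rev (map f (queries K m)) = truth_table (K * bitlen m) (restr (m - K * bitlen m) f)"
proof -
  let ?k = "K * bitlen m"
  have "replicate m True = replicate ?k True @ replicate (m - ?k) True"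
    using assms by (simp add: replicate_add[symmetric])
  then show ?thesis
    unfolding queries_def countdown_eq_n_lists truth_table_def restr_def
    using countdown_eq_n_lists[of ?k "replicate (m - ?k) True"]
    by (simp add: rev_map comp_def)
qed

lemma map_rev_bitstrings: "map_pmf rev (pmf_of_set (bitstrings n)) = pmf_of_set (bitstrings n)"
proof -
  have "rev ` bitstrings n = bitstrings n"
  proof (intro set_eqI iffI)
    fix x :: "bool list" assume "x \<in> bitstrings n"
    then show "x \<in> rev ` bitstrings n"
      by (intro image_eqI[of _ _ "rev x"]) (auto simp: bitstrings_def)
  qed (auto simp: bitstrings_def)
  then show ?thesis using map_pmf_of_set_inj[of rev "bitstrings n"] by simp
qed

text \<open>The reversal of the sampled table disappears because reversal preserves the uniform
  distribution. What remains compares two tables symmetrically, so for a random oracle both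
  components have the same law.\<close>

lemma accept_prob_dist:
  assumes P: "deterministic P" "stack_bound P \<le> N" "2 \<le> N"
    and A: "\<And>x. run P (\<lambda>_. False) x (poly p (length x)) = return_pmf ([], out x)"
    and t: "dist_time N K p m ((2 * m + 1) ^ K) \<le> t"
    and km: "K * bitlen m \<le> m" and F: "finite F" "F \<noteq> {}"
  shows "accept_prob (dist_prog N K P) F m t = measure_pmf.prob
     (pair_pmf (map_pmf (\<lambda>f. truth_table (K * bitlen m) (restr (m - K * bitlen m) f)) (pmf_of_set F))
        (pmf_of_set (bitstrings (2 ^ (K * bitlen m)))))
     {(g, h). out_value (out g) < out_value (out h)}"
proof -
  let ?R = "pmf_of_set (bitstrings (2 ^ (K * bitlen m)))"
  let ?G = "\<lambda>f. truth_table (K * bitlen m) (restr (m - K * bitlen m) f)"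
  have "accept_prob (dist_prog N K P) F m t = measure_pmf.prob (pair_pmf (pmf_of_set F) ?R)
      {(f, H). out_value (out (?G f)) < out_value (out (rev H))}"
  proof (rule accept_prob_eq[OF _ F])
    fix f
    show "map_pmf (\<lambda>(ps, s). (ps, s 0)) (run (dist_prog N K P) f (replicate m True) t) =
      map_pmf (\<lambda>H. ([], flag (out_value (out (?G f)) < out_value (out (rev H))))) ?R"
      using run_dist[OF P A, of K "replicate m True" "(2 * m + 1) ^ K" t f] power_bitlen_le_poly[of K m] t
        queries_eq[OF km, of f] by simp
  qed
  also have "\<dots> = measure_pmf.prob (map_pmf (map_prod ?G rev) (pair_pmf (pmf_of_set F) ?R))
      {(g, h). out_value (out g) < out_value (out h)}"
    unfolding measure_map_pmf by (intro arg_cong[where f = "measure _"]) auto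
  also have "map_pmf (map_prod ?G rev) (pair_pmf (pmf_of_set F) ?R) =
      pair_pmf (map_pmf ?G (pmf_of_set F)) (map_pmf rev ?R)"
    by (simp add: map_pair map_prod_def)
  finally show ?thesis unfolding map_rev_bitstrings .
qed


section \<open>Pseudorandom functions have unbounded complexity\<close>

fun pops :: "nat \<Rightarrow> prog" where
  "pops 0 = Skip"
| "pops (Suc n) = Seq (Pop 0) (pops n)"

fun push_list :: "bool list \<Rightarrow> prog" where
  "push_list [] = Skip"
| "push_list (b # bs) = Seq (push_list bs) (Push 0 b)"

text \<open>The tail is asked first so that the answers pile up in the order of the list.\<close>

fun ask :: "bool list list \<Rightarrow> prog" where
  "ask [] = Skip"
| "ask (x # xs) = Seq (ask xs) (Seq (push_list x) (Seq (Query 0 1) (pops (length x))))"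

fun check :: "bool list \<Rightarrow> prog" where
  "check [] = Push 0 True"
| "check (b # g) = (let p = Seq (Pop 1) (check g) in
     Branch 1 (if b then p else Skip) (if b then Skip else p) Skip)"

lemma loop_free_pops [simp]: "loop_free (pops n)"
  by (induction n) auto

lemma loop_free_push_list [simp]: "loop_free (push_list xs)"
  by (induction xs) auto

lemma loop_free_ask [simp]: "loop_free (ask xs)"
  by (induction xs) auto

lemma loop_free_check [simp]: "loop_free (check g)"
  by (induction g) (auto simp: Let_def)

lemma eval_pops: "eval_lf f (pops n) s = s(0 := drop n (s 0))"
  by (induction n arbitrary: s) (auto simp: fun_eq_iff drop_Suc)

lemma eval_push_list: "eval_lf f (push_list xs) s = s(0 := xs @ s 0)"
  by (induction xs) (auto simp: fun_eq_iff)

lemma eval_ask: "eval_lf f (ask xs) s = s(1 := map (\<lambda>x. f (x @ s 0)) xs @ s 1)"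
  by (induction xs) (auto simp: fun_eq_iff eval_pops eval_push_list)

lemma eval_check: "eval_lf f (check g) s 0 = (if take (length g) (s 1) = g then True # s 0 else s 0)"
proof (induction g arbitrary: s)
  case (Cons b g)
  then show ?case by (cases "s 1") (auto simp: Let_def)
qed simp

text \<open>With \<open>k\<close> and \<open>g\<close> fixed, all \<open>2 ^ k\<close> queries are
  hardwired and cost a constant; only erasing the rest of the input depends on its length. Dropping
  \<open>k\<close> bits from the input leaves the common suffix of the queries.\<close>

definition realize_prog :: "nat \<Rightarrow> bool list list \<Rightarrow> bool list \<Rightarrow> prog" where
  "realize_prog k xs g = Seq (Seq (pops k) (ask xs)) (Seq (clear 0) (check g))"

definition realize_time :: "nat \<Rightarrow> bool list list \<Rightarrow> bool list \<Rightarrow> nat \<Rightarrow> nat" where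
  "realize_time k xs g m = cost (Seq (pops k) (ask xs)) + cost (check g) + 3 + 2 * m"

lemma run_realize:
  assumes "length g = length xs" "realize_time k xs g (length x) \<le> t"
  shows "\<exists>s. run (realize_prog k xs g) f x t = return_pmf ([], s) \<and>
    s 0 = flag (map (\<lambda>y. f (y @ drop k x)) xs = g)"
proof -
  define s0 :: store where "s0 = (\<lambda>_. [])(0 := x)"
  define s1 where "s1 = eval_lf f (Seq (pops k) (ask xs)) s0"
  define s2 where "s2 = s1(0 := [])"
  define s3 where "s3 = eval_lf f (check g) s2"
  have 1: "ev f (Seq (pops k) (ask xs)) s0 s1 (cost (Seq (pops k) (ask xs)))"
    unfolding s1_def by (rule ev_loop_free) simp
  have s1: "s1 0 = drop k x" "s1 1 = map (\<lambda>y. f (y @ drop k x)) xs"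
    by (simp_all add: s1_def eval_pops eval_ask s0_def)
  have 2: "ev f (clear 0) s1 s2 (2 * length x + 1)"
    unfolding s2_def by (rule ev_mono[OF ev_clear]) (use s1 in simp)
  have 3: "ev f (check g) s2 s3 (cost (check g))"
    unfolding s3_def by (rule ev_loop_free) simp
  have "ev f (realize_prog k xs g) s0 s3 (realize_time k xs g (length x))"
    unfolding realize_prog_def
    by (rule ev_mono[OF ev_Seq[OF 1 ev_Seq[OF 2 3]]]) (simp add: realize_time_def)
  from iter_ev[OF this assms(2)] have "run (realize_prog k xs g) f x t = return_pmf ([], s3)"
    by (simp add: run_eq_iter s0_def)
  moreover have "s3 0 = flag (map (\<lambda>y. f (y @ drop k x)) xs = g)"
    using s1 assms(1) by (simp add: s3_def eval_check s2_def)
  ultimately show ?thesis by blast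
qed

lemma accept_prob_realize:
  assumes "k \<le> m" "g \<in> bitstrings (2 ^ k)" "finite F" "F \<noteq> {}"
    "realize_time k (List.n_lists k [False, True]) g m \<le> t"
  shows "accept_prob (realize_prog k (List.n_lists k [False, True]) g) F m t =
    measure_pmf.prob (map_pmf (\<lambda>f. truth_table k (restr (m - k) f)) (pmf_of_set F)) {g}"
proof -
  let ?xs = "List.n_lists k [False, True]"
  have g: "length g = length ?xs" using assms(2) by (simp add: bitstrings_def length_n_lists_bool)
  have "accept_prob (realize_prog k ?xs g) F m t =
      measure_pmf.prob (pair_pmf (pmf_of_set F) (return_pmf ())) {(f, H). truth_table k (restr (m - k) f) = g}"
  proof (rule accept_prob_eq[OF _ assms(3,4)])
    fix f
    have "drop k (replicate m True) = replicate (m - k) True" by simp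
    then show "map_pmf (\<lambda>(ps, s). (ps, s 0)) (run (realize_prog k ?xs g) f (replicate m True) t) =
        map_pmf (\<lambda>H. ([], flag (truth_table k (restr (m - k) f) = g))) (return_pmf ())"
      using run_realize[OF g, of k "replicate m True" t f] assms(5)
      by (auto simp: truth_table_def restr_def)
  qed
  also have "\<dots> = measure_pmf.prob (map_pmf fst (pair_pmf (pmf_of_set F) (return_pmf ())))
      {f. truth_table k (restr (m - k) f) = g}"
    unfolding measure_map_pmf by (intro arg_cong[where f = "measure _"]) auto
  also have "\<dots> = measure_pmf.prob (map_pmf (\<lambda>f. truth_table k (restr (m - k) f)) (pmf_of_set F)) {g}"
    unfolding map_fst_pair_pmf measure_map_pmf by (intro arg_cong[where f = "measure _"]) auto
  finally show ?thesis .
qed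

lemma prfe_finite: "prfe F \<Longrightarrow> finite (F n)" "prfe F \<Longrightarrow> F n \<noteq> {}" "prfe F \<Longrightarrow> F n \<subseteq> boolfuns n"
  unfolding prfe_def using finite_subset[OF _ finite_boolfuns] by blast+

text \<open>The constant polynomial \<open>1 / \<delta>\<close> is enough, since both distinguishers
  below have advantages bounded away from zero.\<close>

lemma prfe_gap:
  assumes "prfe F" "time_bound M p" "\<delta> > 0"
  shows "\<forall>\<^sub>F n in sequentially.
    \<bar>accept_prob M (F n) n (poly p n) - accept_prob M (boolfuns n) n (poly p n)\<bar> \<le> \<delta>"
proof -
  have "\<forall>q :: real poly. (\<forall>\<^sub>F n in sequentially. poly q (real n) > 0) \<longrightarrow>
      (\<forall>\<^sub>F n in sequentially.
        \<bar>accept_prob M (F n) n (poly p n) - accept_prob M (boolfuns n) n (poly p n)\<bar> \<le> 1 / poly q (real n))"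
    using assms unfolding prfe_def by blast
  from this[rule_format, of "[:1 / \<delta>:]"] assms(3) show ?thesis by simp
qed

lemma prfe_realizes:
  assumes "prfe F" and g: "g \<in> bitstrings (2 ^ k)"
  shows "\<forall>\<^sub>F m in sequentially. \<exists>f \<in> F m. truth_table k (restr (m - k) f) = g"
proof -
  let ?xs = "List.n_lists k [False, True]"
  let ?M = "realize_prog k ?xs g"
  define p where "p = [:cost (Seq (pops k) (ask ?xs)) + cost (check g) + 3, 2:]"
  have p: "poly p m = realize_time k ?xs g m" for m
    by (simp add: p_def realize_time_def)
  have glen: "length g = length ?xs" using g by (simp add: bitstrings_def length_n_lists_bool)
  have tb: "time_bound ?M p"
    unfolding time_bound_def
  proof (intro allI ballI)
    fix f x c assume "c \<in> set_pmf (run ?M f x (poly p (length x)))"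
    moreover obtain s where "run ?M f x (poly p (length x)) = return_pmf ([], s)"
      using run_realize[OF glen, of k x "poly p (length x)" f] p by auto
    ultimately show "fst c = []" by simp
  qed
  \<comment> \<open>Half the probability that a random oracle shows the table \<open>g\<close>. It
    does not depend on \<open>m\<close>, and staying within it forces a positive probability for
    \<open>F m\<close>.\<close>
  define \<delta> :: real where "\<delta> = 1 / (2 * 2 ^ (2 ^ k))"
  have "\<delta> > 0" by (simp add: \<delta>_def)
  from prfe_gap[OF assms(1) tb this] eventually_ge_at_top[of k]
  show ?thesis
  proof eventually_elim
    case (elim m)
    have "map_pmf (\<lambda>f. truth_table k (restr (m - k) f)) (pmf_of_set (boolfuns m)) =
        pmf_of_set (bitstrings (2 ^ k))"
      using truth_table_restr_uniform[of k "m - k"] elim(2) by simp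
    then have "accept_prob ?M (boolfuns m) m (poly p m) = 1 / 2 ^ (2 ^ k)"
      using accept_prob_realize[OF elim(2) g, of "boolfuns m" "poly p m"] g
      by (simp add: p measure_pmf_single)
    also have "1 / 2 ^ (2 ^ k) = 2 * \<delta>" by (simp add: \<delta>_def)
    finally have "accept_prob ?M (F m) m (poly p m) \<noteq> 0"
      using elim(1) \<open>\<delta> > 0\<close> by linarith
    then have "measure_pmf.prob (map_pmf (\<lambda>f. truth_table k (restr (m - k) f)) (pmf_of_set (F m))) {g} \<noteq> 0"
      using accept_prob_realize[OF elim(2) g prfe_finite(1,2)[OF assms(1)], of "poly p m" m] by (simp add: p)
    then have "g \<in> set_pmf (map_pmf (\<lambda>f. truth_table k (restr (m - k) f)) (pmf_of_set (F m)))"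
      unfolding measure_pmf_single set_pmf_iff .
    then show ?case using prfe_finite(1,2)[OF assms(1)] by auto
  qed
qed

lemma (in model_class) prfe_complexity_unbounded:
  assumes "prfe F" and u: "\<And>n. u n = Max (complexity computes msize n ` F n)"
  shows "\<forall>\<^sub>F m in sequentially. s < u m"
proof -
  obtain k f0 where f0: "f0 \<in> boolfuns k" "\<And>M. computes M k f0 \<Longrightarrow> s < msize M"
    using unbounded by blast
  have s: "s < complexity computes msize k f0"
    using complexity_witness[OF f0(1)] f0(2) by metis
  from prfe_realizes[OF assms(1) truth_table_in_bitstrings[of k f0]] eventually_ge_at_top[of k]
  show ?thesis
  proof eventually_elim
    case (elim m)
    then obtain f where f: "f \<in> F m" "truth_table k (restr (m - k) f) = truth_table k f0" by blast
    have fb: "f \<in> boolfuns (k + (m - k))" using f(1) prfe_finite(3)[OF assms(1)] elim(2) by auto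
    have "restr (m - k) f = f0"
      using inj_onD[OF truth_table_inj f(2) restr_in_boolfuns[OF fb] f0(1)] .
    then have "complexity computes msize k f0 \<le> complexity computes msize m f"
      using complexity_restr[OF fb] elim(2) by simp
    also have "\<dots> \<le> u m"
      unfolding u using f(1) prfe_finite(1)[OF assms(1)] by (intro Max_ge) auto
    finally show ?case using s by simp
  qed
qed


section \<open>Asymptotics\<close>

lemma eventually_bitlen_ge: "\<forall>\<^sub>F m in sequentially. b \<le> bitlen m"
  using eventually_ge_at_top[of "2 ^ b"]
proof eventually_elim
  case (elim m)
  then have "(2::nat) ^ b < 2 ^ bitlen m" using less_power_bitlen[of m] by linarith
  then show ?case by simp
qed

lemma eventually_bitlen_le: "\<forall>\<^sub>F m in sequentially. K * bitlen m \<le> m"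
proof -
  have "\<forall>\<^sub>F b in sequentially. real b * (2 * real K) < 2 ^ b"
    by real_asymp
  then obtain b0 where b0: "\<And>b. b \<ge> b0 \<Longrightarrow> real b * (2 * real K) < 2 ^ b"
    unfolding eventually_sequentially by blast
  from eventually_bitlen_ge[of b0] eventually_gt_at_top[of 0] show ?thesis
  proof eventually_elim
    case (elim m)
    have "real (bitlen m * (2 * K)) < real (2 ^ bitlen m)" using b0[OF elim(1)] by simp
    then have "bitlen m * (2 * K) < 2 ^ bitlen m" by (simp only: of_nat_less_iff)
    also have "\<dots> \<le> 2 * m" by (rule power_bitlen_le[OF elim(2)])
    finally show ?case by (simp add: mult.commute)
  qed
qed

text \<open>Take the last index at which the minimum over all indices from \<open>n0\<close> on is
  attained. Divergence makes the set of such indices finite, and later values are at least the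
  minimum but different from it.\<close>

lemma infinitely_many_strict_tail_minima:
  fixes v :: "nat \<Rightarrow> nat"
  assumes "\<And>s. \<forall>\<^sub>F n in sequentially. s < v n"
  shows "\<exists>n\<ge>n0. \<forall>k>n. v n < v k"
proof -
  define c where "c = (LEAST c. \<exists>n\<ge>n0. v n = c)"
  have ex: "\<exists>n\<ge>n0. v n = c" unfolding c_def by (rule LeastI[of _ "v n0"]) auto
  have le: "c \<le> v n" if "n \<ge> n0" for n unfolding c_def by (rule Least_le) (use that in auto)
  obtain n1 where n1: "\<And>n. n \<ge> n1 \<Longrightarrow> c < v n"
    using assms[of c] unfolding eventually_sequentially by blast
  define S where "S = {n. n \<ge> n0 \<and> v n = c}"
  have "n < n1" if "n \<in> S" for n using n1[of n] that by (cases "n < n1") (auto simp: S_def)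
  then have "S \<subseteq> {..<n1}" by auto
  then have fin: "finite S" using finite_subset by blast
  have ne: "S \<noteq> {}" using ex by (auto simp: S_def)
  have "v (Max S) < v k" if "k > Max S" for k
  proof -
    have m: "Max S \<in> S" by (rule Max_in[OF fin ne])
    then have "k \<notin> S" using that Max_ge[OF fin, of k] by auto
    then show ?thesis using le[of k] m that by (auto simp: S_def)
  qed
  moreover have "Max S \<ge> n0" using Max_in[OF fin ne] by (auto simp: S_def)
  ultimately show ?thesis by blast
qed

lemma filterlim_floor_exponential:
  assumes "\<epsilon> > 0"
  shows "filterlim (\<lambda>n. nat \<lfloor>2 powr (real n / \<epsilon>)\<rfloor>) at_top sequentially"
proof -
  have "filterlim (\<lambda>n. 2 powr (real n / \<epsilon>)) at_top sequentially"
    using assms by real_asymp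
  then have "\<forall>\<^sub>F n in sequentially. real Z \<le> 2 powr (real n / \<epsilon>)" for Z
    unfolding filterlim_at_top by blast
  then show ?thesis
    unfolding filterlim_at_top by (intro allI, elim meta_allE, eventually_elim) (rule le_nat_floor)
qed

text \<open>Rounding down loses less than one, and \<open>m + 1 \<le> 2 ^ bitlen m\<close> recovers
  it. So the inequality is strict although the exponential was truncated.\<close>

lemma less_bitlen_floor_exponential:
  assumes "\<epsilon> > 0" "\<epsilon> \<le> real K"
  shows "n < K * bitlen (nat \<lfloor>2 powr (real n / \<epsilon>)\<rfloor>)"
proof -
  define m where "m = nat \<lfloor>2 powr (real n / \<epsilon>)\<rfloor>"
  have "2 powr (real n / \<epsilon>) < real m + 1"
    unfolding m_def by linarith
  also have "\<dots> \<le> 2 ^ bitlen m"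
    using less_power_bitlen[of m] by (metis Suc_leI of_nat_Suc of_nat_le_iff of_nat_numeral of_nat_power add.commute)
  also have "\<dots> = 2 powr real (bitlen m)" by (simp add: powr_realpow)
  finally have "real n / \<epsilon> < real (bitlen m)" by simp
  then have "real n < \<epsilon> * real (bitlen m)" using assms(1) by (simp add: field_simps)
  also have "\<dots> \<le> real K * real (bitlen m)" using assms(2) by (intro mult_right_mono) auto
  also have "\<dots> = real (K * bitlen m)" by simp
  finally show ?thesis unfolding m_def of_nat_less_iff .
qed


section \<open>Hardness of approximating the complexity\<close>

lemma prob_pair_ge:
  assumes "\<And>g h. g \<in> set_pmf p \<Longrightarrow> h \<in> S \<Longrightarrow> h \<in> set_pmf q \<Longrightarrow> (g, h) \<in> B"
  shows "measure_pmf.prob q S \<le> measure_pmf.prob (pair_pmf p q) B"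
proof -
  have "measure_pmf.prob q S = measure_pmf.prob (map_pmf snd (pair_pmf p q)) S"
    by (simp add: map_snd_pair_pmf)
  also have "\<dots> = measure_pmf.prob (pair_pmf p q) (snd -` S)"
    by (simp add: measure_map_pmf)
  also have "\<dots> \<le> measure_pmf.prob (pair_pmf p q) B"
    by (rule measure_pmf.finite_measure_mono_AE) (use assms in \<open>auto simp: AE_measure_pmf_iff\<close>)
  finally show ?thesis .
qed

theorem mainTheorem16:
  fixes computes :: "'m \<Rightarrow> nat \<Rightarrow> boolfun \<Rightarrow> bool"
    and msize :: "'m \<Rightarrow> nat"
    and C :: "nat \<Rightarrow> boolfun \<Rightarrow> nat"
    and l \<alpha> :: "nat \<Rightarrow> real"
    and u :: "nat \<Rightarrow> nat"
    and F :: "nat \<Rightarrow> boolfun set"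
    and \<epsilon> :: real
  defines "C \<equiv> complexity computes msize"
  assumes models: "model_class computes msize"
    and hard: "\<exists>c>0. \<forall>\<^sub>F n in sequentially.
      real (card {f \<in> boolfuns n. real (C n f) \<ge> l n}) / real (card (boolfuns n))
        \<ge> 1 - exp (- c * real n)"
    and prfe: "prfe F"
    and u: "\<And>n. u n = Max (C n ` F n)"
    and eps: "\<epsilon> > 0"
    and alpha: "\<And>n. \<alpha> n > 0"
    and gap: "\<forall>\<^sub>F n in sequentially.
      real (u (nat \<lfloor>2 powr (real n / \<epsilon>)\<rfloor>)) \<le> 1 / (\<alpha> n)\<^sup>2 * l n"
  shows "\<not> (\<exists>A. poly_time_computable A \<and>
    (\<forall>n. \<forall>f \<in> boolfuns n.
      real (C n f) / \<alpha> n \<le> A (truth_table n f) \<and>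
      A (truth_table n f) \<le> \<alpha> n * real (C n f)))"
proof
  interpret model_class computes msize by (rule models)
  note C = \<open>C \<equiv> complexity computes msize\<close>
  assume "\<exists>A. poly_time_computable A \<and>
    (\<forall>n. \<forall>f \<in> boolfuns n.
      real (C n f) / \<alpha> n \<le> A (truth_table n f) \<and>
      A (truth_table n f) \<le> \<alpha> n * real (C n f))"
  then obtain A P p where P: "deterministic P"
    and run: "\<And>x. \<exists>s. run P (\<lambda>_. False) x (poly p (length x)) = return_pmf ([], s) \<and> A x = out_value s"
    and approx: "\<And>n f. f \<in> boolfuns n \<Longrightarrow> real (C n f) / \<alpha> n \<le> A (truth_table n f)"
      "\<And>n f. f \<in> boolfuns n \<Longrightarrow> A (truth_table n f) \<le> \<alpha> n * real (C n f)"
    unfolding poly_time_computable_def by blast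
  from run obtain out where
    out: "\<And>x. run P (\<lambda>_. False) x (poly p (length x)) = return_pmf ([], out x)"
    and A: "\<And>x. A x = out_value (out x)" by metis
  \<comment> \<open>At least 2, so that the output stacks 0 and 1 belong to the region cleared
    between the two runs of the algorithm.\<close>
  define N where "N = max 2 (stack_bound P)"
  have N: "stack_bound P \<le> N" "2 \<le> N" by (simp_all add: N_def)
  \<comment> \<open>An integer that can be hardwired into the program in place of the real
    \<open>\<epsilon>\<close>.\<close>
  define K where "K = nat \<lceil>\<epsilon>\<rceil>"
  have K: "\<epsilon> \<le> real K" unfolding K_def by linarith
  define \<mu> where "\<mu> n = nat \<lfloor>2 powr (real n / \<epsilon>)\<rfloor>" for n
  define M where "M = dist_prog N K P"
  obtain pt where pt: "\<And>m. dist_time N K p m ((2 * m + 1) ^ K) \<le> poly pt m"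
    using poly_bounded_dist_time[of N K p] unfolding poly_bounded_def by blast
  have tb: "time_bound M pt"
    unfolding time_bound_def M_def using run_dist_halts[OF P N out pt] by blast
  have \<mu>: "filterlim \<mu> at_top sequentially"
    using filterlim_floor_exponential[OF eps] unfolding \<mu>_def .
  have uev: "\<forall>\<^sub>F n in sequentially. s < u n" for s
    by (rule prfe_complexity_unbounded[OF prfe]) (simp add: u C)
  have u\<mu>: "\<forall>\<^sub>F n in sequentially. s < u (\<mu> n)" for s
    using filterlim_iff[THEN iffD1, OF \<mu>] uev by blast
  obtain c where c: "c > 0" "\<forall>\<^sub>F n in sequentially.
      real (card {f \<in> boolfuns n. real (C n f) \<ge> l n}) / real (card (boolfuns n))
        \<ge> 1 - exp (- c * real n)"
    using hard by blast
  have "\<forall>\<^sub>F n in sequentially. exp (- c * real n) < 1 / 4"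
    using c(1) by real_asymp
  then have "\<forall>\<^sub>F n in sequentially.
      real (card {f \<in> boolfuns n. real (C n f) \<ge> l n}) / real (card (boolfuns n)) \<ge> 3 / 4"
    using c(2) by eventually_elim linarith
  with gap have "\<forall>\<^sub>F n in sequentially. real (u (\<mu> n)) \<le> 1 / (\<alpha> n)\<^sup>2 * l n \<and>
      real (card {f \<in> boolfuns n. real (C n f) \<ge> l n}) / real (card (boolfuns n)) \<ge> 3 / 4"
    unfolding \<mu>_def by eventually_elim blast
  then obtain k0 where k0: "\<And>k. k \<ge> k0 \<Longrightarrow> real (u (\<mu> k)) \<le> 1 / (\<alpha> k)\<^sup>2 * l k"
    "\<And>k. k \<ge> k0 \<Longrightarrow>
      real (card {f \<in> boolfuns k. real (C k f) \<ge> l k}) / real (card (boolfuns k)) \<ge> 3 / 4"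
    unfolding eventually_sequentially by blast
  have "\<forall>\<^sub>F m in sequentially.
      \<bar>accept_prob M (F m) m (poly pt m) - accept_prob M (boolfuns m) m (poly pt m)\<bar> \<le> 1 / 8 \<and>
      K * bitlen m \<le> m"
    using prfe_gap[OF prfe tb, of "1 / 8"] eventually_bitlen_le[of K]
    by (auto intro: eventually_conj)
  then have "\<forall>\<^sub>F n in sequentially.
      \<bar>accept_prob M (F (\<mu> n)) (\<mu> n) (poly pt (\<mu> n)) - accept_prob M (boolfuns (\<mu> n)) (\<mu> n) (poly pt (\<mu> n))\<bar> \<le> 1 / 8 \<and>
      K * bitlen (\<mu> n) \<le> \<mu> n"
    using filterlim_iff[THEN iffD1, OF \<mu>] by blast
  then obtain n0 where n0: "\<And>n. n \<ge> n0 \<Longrightarrow>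
      \<bar>accept_prob M (F (\<mu> n)) (\<mu> n) (poly pt (\<mu> n)) - accept_prob M (boolfuns (\<mu> n)) (\<mu> n) (poly pt (\<mu> n))\<bar> \<le> 1 / 8"
      "\<And>n. n \<ge> n0 \<Longrightarrow> K * bitlen (\<mu> n) \<le> \<mu> n"
    unfolding eventually_sequentially by blast
  \<comment> \<open>A single index beyond all thresholds suffices. Since \<open>k\<close> will
    exceed \<open>n\<close>, the facts \<open>k0\<close> apply at \<open>k\<close> as well.\<close>
  from infinitely_many_strict_tail_minima[of "\<lambda>n. u (\<mu> n)" "max n0 k0", OF u\<mu>]
  obtain n where n: "n \<ge> n0" "n \<ge> k0" "\<And>k. k > n \<Longrightarrow> u (\<mu> n) < u (\<mu> k)" by auto
  define m where "m = \<mu> n"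
  define k where "k = K * bitlen m"
  have km: "k \<le> m" using n0(2)[OF n(1)] by (simp add: k_def m_def)
  have nk: "n < k" unfolding k_def m_def \<mu>_def by (rule less_bitlen_floor_exponential[OF eps K])
  then have kk0: "k \<ge> k0" using n(2) by simp
  let ?G = "\<lambda>f. truth_table k (restr (m - k) f)"
  let ?U = "pmf_of_set (bitstrings (2 ^ k))"
  let ?B = "{(g, h). A g < A h}"
  have acc: "accept_prob M X m (poly pt m) =
      measure_pmf.prob (pair_pmf (map_pmf ?G (pmf_of_set X)) ?U) ?B" if "finite X" "X \<noteq> {}" for X
    using accept_prob_dist[OF P N out pt km[unfolded k_def] that] unfolding M_def k_def A .
  have "map_pmf ?G (pmf_of_set (boolfuns m)) = ?U"
    using truth_table_restr_uniform[of k "m - k"] km by simp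
  then have random: "accept_prob M (boolfuns m) m (poly pt m) \<le> 1 / 2"
    using acc[of "boolfuns m"] pair_pmf_symmetric_le_half[of ?U A] by simp
  define H where "H = {h \<in> boolfuns k. real (C k h) \<ge> l k}"
  have less: "A (?G f) < A (truth_table k h)" if f: "f \<in> F m" and h: "h \<in> H" for f h
  proof -
    have fb: "f \<in> boolfuns (k + (m - k))" using f km prfe_finite(3)[OF prfe, of m] by auto
    have "C k (restr (m - k) f) \<le> C m f"
      using complexity_restr[OF fb] km by (simp add: C)
    also have "\<dots> \<le> u m"
      unfolding u using f prfe_finite(1)[OF prfe] by (intro Max_ge) auto
    also have "\<dots> < u (\<mu> k)" unfolding m_def by (rule n(3)[OF nk])
    finally have Cless: "C k (restr (m - k) f) < u (\<mu> k)" .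
    have "A (?G f) \<le> \<alpha> k * real (C k (restr (m - k) f))"
      by (rule approx(2)[OF restr_in_boolfuns[OF fb]])
    also have "\<dots> < \<alpha> k * real (u (\<mu> k))"
      using Cless alpha[of k] by (intro mult_strict_left_mono) auto
    \<comment> \<open>One factor \<open>\<alpha> k\<close> comes from the upper estimate for
      \<open>A\<close>. Of the \<open>(\<alpha> k)\<^sup>2\<close> in the gap, the other factor pays
      for the lower estimate on the hard function.\<close>
    also have "\<dots> \<le> \<alpha> k * (1 / (\<alpha> k)\<^sup>2 * l k)"
      using k0(1)[OF kk0] alpha[of k] by (intro mult_left_mono) auto
    also have "\<dots> = l k / \<alpha> k"
      using alpha[of k] by (simp add: power2_eq_square)
    also have "\<dots> \<le> real (C k h) / \<alpha> k"
      using h alpha[of k] by (intro divide_right_mono) (auto simp: H_def)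
    also have "\<dots> \<le> A (truth_table k h)"
      using h by (intro approx(1)) (simp add: H_def)
    finally show ?thesis .
  qed
  have "3 / 4 \<le> measure_pmf.prob (pmf_of_set (boolfuns k)) H"
    using k0(2)[OF kk0] by (simp add: measure_pmf_of_set H_def Int_def conj_commute conj_left_commute)
  \<comment> \<open>The sampled object is a table, so the set of hard functions is carried to its
    image under \<open>truth_table k\<close>, using that a uniform function has a uniform
    table.\<close>
  also have "\<dots> \<le> measure_pmf.prob (pmf_of_set (boolfuns k)) (truth_table k -` truth_table k ` H)"
    by (intro measure_pmf.finite_measure_mono) auto
  also have "\<dots> = measure_pmf.prob ?U (truth_table k ` H)"
    unfolding truth_table_uniform[symmetric] measure_map_pmf ..
  also have "\<dots> \<le> measure_pmf.prob (pair_pmf (map_pmf ?G (pmf_of_set (F m))) ?U) ?B"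
    by (rule prob_pair_ge) (use less prfe_finite(1,2)[OF prfe] in auto)
  also have "\<dots> = accept_prob M (F m) m (poly pt m)"
    using acc[OF prfe_finite(1,2)[OF prfe]] by simp
  \<comment> \<open>The acceptance probability is at least 3/4 for \<open>F m\<close> and at most
    1/2 for a random oracle, while pseudorandomness allows a difference of only 1/8.\<close>
  finally show False
    using random n0(1)[OF n(1)] unfolding m_def[symmetric] by linarith
qed

end
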